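(* Let $V$ be a 2-dimensional complex vector space and let $0\le\theta\le\pi$. Let $R=R(\theta):V^{\otimes 3}\to V^{\otimes 3}$ be the $(2,3,1)$ generalized Yang-Baxter operator of type I, i.e. the operator represented on the lexicographically ordered basis of $V^{\otimes 3}$ by $$R(\theta)=\frac{1}{\sqrt{2}}\begin{pmatrix}1&0&1&0\\ 0&i&0&e^{i\theta}\\-i&0&i&0\\0&-ie^{-i\theta}&0&1\end{pmatrix}\oplus\frac{1}{\sqrt{2}}\begin{pmatrix}i&0&e^{i\theta}&0\\ 0&1&0&-e^{2i\theta}\\-ie^{-i\theta}&0&1&0\\0&ie^{-2i\theta}&0&i\end{pmatrix}.$$ Let $\mu=\mathrm{Id}_V$, $\alpha=e^{i\pi/4}$, $\beta=1$. Then $S=(R,\mu,\alpha,\beta)$ is an enhanced generalized Yang-Baxter operator (with $k=3$, $m=1$) whose associated oriented link invariant $T_S$ satisfies $$T_S(L_+)+T_S(L_-)=T_S(L_0)$$ for every triple $(L_-,L_0,L_+)$, and $T_S(G_n)=2^{n+1}$ for all $n\ge 1$, where $G_n$ is the trivial $n$-component link.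
   Context: $V$ is a finite-dimensional complex vector space of dimension $d$; $I_m$ denotes the identity of $V^{\otimes m}$. $B_n$ is the braid group with generators $\sigma_1,\dots,\sigma_{n-1}$ (positive crossings) and relations $\sigma_i\sigma_j=\sigma_j\sigma_i$ for $|i-j|\ge 2$, $\sigma_i\sigma_{i+1}\sigma_i=\sigma_{i+1}\sigma_i\sigma_{i+1}$. Operator trace. For a basis $v_1,\dots,v_d$ of $V$ and $f\in\mathrm{End}(V^{\otimes k})$ write $f(v_{i_1}\otimes\cdots\otimes v_{i_k})=\sum f^{j_1,\dots,j_k}_{i_1,\dots,i_k}v_{j_1}\otimes\cdots\otimes v_{j_k}$. For $m<k$, $\mathrm{Sp}_{k,m}:\mathrm{End}(V^{\otimes k})\to\mathrm{End}(V^{\otimes (k-m)})$ is the partial trace over the last $m$ tensor factors: $\mathrm{Sp}_{k,m}(f)(v_{i_1}\otimes\cdots\otimes v_{i_{k-m}})=\sum_{j_1,\dots,j_{k-m},l_1,\dots,l_m}f^{j_1,\dots,j_{k-m},l_1,\dots,l_m}_{i_1,\dots,i_{k-m},l_1,\dots,l_m}v_{j_1}\otimes\cdots\otimes v_{j_{k-m}}$ (independent of the basis). Generalized Yang-Baxter operator (gYB-operator) of type $(d,k,m)$: an isomorphism $R:V^{\otimes k}\to V^{\otimes k}$, $\dim V=d$, with $(R\otimes I_m)(I_m\otimes R)(R\otimes I_m)=(I_m\otimes R)(R\otimes I_m)(I_m\otimes R)$ and $(R\otimes I_m^{\otimes(j-2)})(I_m^{\otimes(j-2)}\otimes R)=(I_m^{\otimes(j-2)}\otimes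 R)(R\otimes I_m^{\otimes(j-2)})$ for all $j\ge 4$. It gives a representation $\rho^R_n:B_n\to\mathrm{End}(V^{\otimes k+m(n-2)})$, $\sigma_i\mapsto I_m^{\otimes(i-1)}\otimes R\otimes I_m^{\otimes(n-i-1)}$, with image $\mathrm{im}(\rho^R_n)$. It is known (R. S. Chen) that the displayed $R(\theta)$ is a unitary gYB-operator of type $(2,3,1)$. Perpendicular subspace: for $A\subset\mathrm{End}(W)$, $A^\perp=\{g\in\mathrm{End}(W):\mathrm{tr}(f^*\circ g)=0\text{ for all }f\in A\}$, where $f^*$ is the hermitian conjugate of $f$ (conjugate transpose in the tensor basis induced by the fixed basis of $V$). Enhanced generalized Yang-Baxter operator (EgYB-operator): fix positive integers $m<k$. It is a collection $S=(R,\mu,\alpha,\beta)$ of a gYB-operator $R:V^{\otimes k}\to V^{\otimes k}$ of type $(d,k,m)$, a linear map $\mu:V\to V$, and invertible $\alpha,\beta\in\mathbb{C}$ such that, for all $n\geq 1$: (i) $\mu^{\otimes k}$ commutes with $R$; (ii) $\mu^{\otimes m(n-1)}\otimes(\mathrm{Sp}_{k,m}(R\circ\mu^{\otimes k})-\alpha\beta\mu^{\otimes (k-m)})\in\mathrm{im}(\rho^R_n)^\perp$ and $\mu^{\otimes m(n-1)}\otimes(\mathrm{Sp}_{k,m}(R^{-1}\circ\mu^{\otimes k})-\alpha^{-1}\beta\mu^{\otimes (k-m)})\in\mathrm{im}(\rho^R_n)^\perp$. The invariant $T_S$: let $w:B_n\to\mathbb{Z}$ be the homomorphism with $w(\sigma_i)=1$.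 For $\xi\in B_n$, $T_S(\xi)=\alpha^{-w(\xi)}\beta^{-n}\,\mathrm{tr}\big(\rho^R_n(\xi)\circ\mu^{\otimes k+m(n-2)}\big)$. For an oriented link $L$, $T_S(L)=T_S(\xi)$ where $\xi$ is any braid whose closure is isotopic to $L$ (well defined, by invariance under Markov moves and Markov's theorem). A triple $(L_-,L_0,L_+)$ consists of oriented links with diagrams identical outside a disk, inside which $L_0$ has two parallel (uncrossed) strands and $L_+$, $L_-$ have one positive, respectively one negative, crossing. Equivalently, there is a braid $\xi\in B_n$ such that $L_0,L_+,L_-$ are the closures of $\xi$, $\sigma_1\xi$, $\sigma_1^{-1}\xi$. *)

theory Defs
  imports
    "HOL-Algebra.Group"
    "Jordan_Normal_Form.Schur_Decomposition"
    "Jordan_Normal_Form.Gauss_Jordan_Elimination"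
begin

section \<open>Operators on tensor powers\<close>

text \<open>The space V is identified with the complex d-space by means of its fixed basis, and the
  N-th tensor power of V with the space of dimension \<open>d ^ N\<close> by means of the lexicographically
  ordered tensor basis.  An endomorphism f is the matrix whose entry in row j and column i is the
  coefficient of the j-th basis vector in the image of the i-th one; the tensor product of maps is
  then the Kronecker product.\<close>

definition kron :: "complex mat \<Rightarrow> complex mat \<Rightarrow> complex mat"  (infixl \<open>\<otimes>\<^sub>k\<close> 72) where
  "A \<otimes>\<^sub>k B = mat (dim_row A * dim_row B) (dim_col A * dim_col B)
     (\<lambda>(i, j). A $$ (i div dim_row B, j div dim_col B) * B $$ (i mod dim_row B, j mod dim_col B))"

fun tensor_pow :: "complex mat \<Rightarrow> nat \<Rightarrow> complex mat" where
  "tensor_pow A 0 = 1\<^sub>m 1"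
| "tensor_pow A (Suc r) = A \<otimes>\<^sub>k tensor_pow A r"

definition mat_trace :: "complex mat \<Rightarrow> complex" where
  "mat_trace A = (\<Sum>i<dim_row A. A $$ (i, i))"

text \<open>Partial trace over the last m of k tensor factors.\<close>

definition Sp :: "nat \<Rightarrow> nat \<Rightarrow> nat \<Rightarrow> complex mat \<Rightarrow> complex mat" where
  "Sp d k m f = mat (d ^ (k - m)) (d ^ (k - m))
     (\<lambda>(j, i). \<Sum>l<d ^ m. f $$ (j * d ^ m + l, i * d ^ m + l))"

definition perp :: "nat \<Rightarrow> complex mat set \<Rightarrow> complex mat set" where
  "perp N A = {g \<in> carrier_mat N N. \<forall>f\<in>A. mat_trace (mat_adjoint f * g) = 0}"

definition mat_inv :: "complex mat \<Rightarrow> complex mat" where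
  "mat_inv A = the (mat_inverse A)"


section \<open>Braid groups\<close>

text \<open>The letter \<open>(i, True)\<close> is the generator with index i, \<open>(i, False)\<close> its inverse.\<close>

type_synonym braid_word = "(nat \<times> bool) list"

definition braid_words :: "nat \<Rightarrow> braid_word set" where
  "braid_words n = lists ({1..<n} \<times> UNIV)"

inductive braid_eq :: "nat \<Rightarrow> braid_word \<Rightarrow> braid_word \<Rightarrow> bool" for n where
  refl: "u \<in> braid_words n \<Longrightarrow> braid_eq n u u"
| sym: "braid_eq n u v \<Longrightarrow> braid_eq n v u"
| trans: "braid_eq n u v \<Longrightarrow> braid_eq n v w \<Longrightarrow> braid_eq n u w"
| cancel: "u @ [(i, b), (i, \<not> b)] @ v \<in> braid_words n \<Longrightarrow>
    braid_eq n (u @ [(i, b), (i, \<not> b)] @ v) (u @ v)"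
| far: "u @ [(i, True), (j, True)] @ v \<in> braid_words n \<Longrightarrow> i + 2 \<le> j \<Longrightarrow>
    braid_eq n (u @ [(i, True), (j, True)] @ v) (u @ [(j, True), (i, True)] @ v)"
| braid: "u @ [(i, True), (Suc i, True), (i, True)] @ v \<in> braid_words n \<Longrightarrow>
    braid_eq n (u @ [(i, True), (Suc i, True), (i, True)] @ v)
               (u @ [(Suc i, True), (i, True), (Suc i, True)] @ v)"

type_synonym braid = "braid_word set"

definition braid_class :: "nat \<Rightarrow> braid_word \<Rightarrow> braid" where
  "braid_class n u = {v. braid_eq n u v}"

definition braid_group :: "nat \<Rightarrow> braid monoid" where
  "braid_group n = \<lparr>carrier = braid_class n ` braid_words n,
     monoid.mult = (\<lambda>X Y. \<Union>u\<in>X. \<Union>v\<in>Y. braid_class n (u @ v)),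
     monoid.one = braid_class n []\<rparr>"

definition braid_gen :: "nat \<Rightarrow> nat \<Rightarrow> braid" where
  "braid_gen n i = braid_class n [(i, True)]"

text \<open>Functions on braids are evaluated on an arbitrary representing word.\<close>

definition some_word :: "braid \<Rightarrow> braid_word" where
  "some_word \<xi> = (SOME u. u \<in> \<xi>)"

definition exponent_sum :: "braid \<Rightarrow> int" where
  "exponent_sum \<xi> = (\<Sum>(i, b)\<leftarrow>some_word \<xi>. if b then 1 else -1)"


section \<open>Generalized Yang-Baxter operators\<close>

definition gYB_operator :: "nat \<Rightarrow> nat \<Rightarrow> nat \<Rightarrow> complex mat \<Rightarrow> bool" where
  "gYB_operator d k m R \<longleftrightarrow>
     R \<in> carrier_mat (d ^ k) (d ^ k) \<and> invertible_mat R \<and>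
     (let I = 1\<^sub>m (d ^ m) in
        (R \<otimes>\<^sub>k I) * (I \<otimes>\<^sub>k R) * (R \<otimes>\<^sub>k I) = (I \<otimes>\<^sub>k R) * (R \<otimes>\<^sub>k I) * (I \<otimes>\<^sub>k R) \<and>
        (\<forall>j\<ge>4. (R \<otimes>\<^sub>k tensor_pow I (j - 2)) * (tensor_pow I (j - 2) \<otimes>\<^sub>k R)
               = (tensor_pow I (j - 2) \<otimes>\<^sub>k R) * (R \<otimes>\<^sub>k tensor_pow I (j - 2))))"

text \<open>The number \<open>k + m(n - 2)\<close> of tensor factors on which n-strand braids act, arranged so that
  the truncated subtraction is harmless for \<open>n \<ge> 1\<close> and \<open>m < k\<close>.\<close>

definition num_factors :: "nat \<Rightarrow> nat \<Rightarrow> nat \<Rightarrow> nat" where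
  "num_factors k m n = k + m * n - 2 * m"

definition letter_rep :: "nat \<Rightarrow> nat \<Rightarrow> complex mat \<Rightarrow> nat \<Rightarrow> nat \<times> bool \<Rightarrow> complex mat" where
  "letter_rep d m R n = (\<lambda>(i, b).
     tensor_pow (1\<^sub>m (d ^ m)) (i - 1) \<otimes>\<^sub>k (if b then R else mat_inv R)
       \<otimes>\<^sub>k tensor_pow (1\<^sub>m (d ^ m)) (n - i - 1))"

definition braid_rep :: "nat \<Rightarrow> nat \<Rightarrow> nat \<Rightarrow> complex mat \<Rightarrow> nat \<Rightarrow> braid \<Rightarrow> complex mat" where
  "braid_rep d k m R n \<xi> =
     foldr (\<lambda>x M. letter_rep d m R n x * M) (some_word \<xi>) (1\<^sub>m (d ^ num_factors k m n))"

definition braid_image :: "nat \<Rightarrow> nat \<Rightarrow> nat \<Rightarrow> complex mat \<Rightarrow> nat \<Rightarrow> complex mat set" where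
  "braid_image d k m R n = braid_rep d k m R n ` carrier (braid_group n)"

definition EgYB_operator ::
  "nat \<Rightarrow> nat \<Rightarrow> nat \<Rightarrow> complex mat \<times> complex mat \<times> complex \<times> complex \<Rightarrow> bool" where
  "EgYB_operator d k m = (\<lambda>(R, \<mu>, \<alpha>, \<beta>).
     0 < m \<and> m < k \<and> gYB_operator d k m R \<and> \<mu> \<in> carrier_mat d d \<and> \<alpha> \<noteq> 0 \<and> \<beta> \<noteq> 0 \<and>
     tensor_pow \<mu> k * R = R * tensor_pow \<mu> k \<and>
     (\<forall>n\<ge>1.
        tensor_pow \<mu> (m * (n - 1)) \<otimes>\<^sub>k
          (Sp d k m (R * tensor_pow \<mu> k) - (\<alpha> * \<beta>) \<cdot>\<^sub>m tensor_pow \<mu> (k - m))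
          \<in> perp (d ^ num_factors k m n) (braid_image d k m R n) \<and>
        tensor_pow \<mu> (m * (n - 1)) \<otimes>\<^sub>k
          (Sp d k m (mat_inv R * tensor_pow \<mu> k) - (inverse \<alpha> * \<beta>) \<cdot>\<^sub>m tensor_pow \<mu> (k - m))
          \<in> perp (d ^ num_factors k m n) (braid_image d k m R n)))"

definition braid_invariant ::
  "nat \<Rightarrow> nat \<Rightarrow> nat \<Rightarrow> complex mat \<times> complex mat \<times> complex \<times> complex \<Rightarrow> nat \<Rightarrow> braid \<Rightarrow> complex"
  where
  "braid_invariant d k m = (\<lambda>(R, \<mu>, \<alpha>, \<beta>) n \<xi>.
     \<alpha> powi (- exponent_sum \<xi>) * \<beta> powi (- int n) *
     mat_trace (braid_rep d k m R n \<xi> * tensor_pow \<mu> (num_factors k m n)))"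


section \<open>Oriented links\<close>

text \<open>An oriented link diagram in general position with respect to the height function is the
  list, read from top to bottom, of its critical points and crossings.  The number p in a slice
  \<open>(p, s)\<close> counts the strands passing to the left of it.
    \<^item> \<open>LMax b\<close> is a local maximum; its left leg points downwards iff \<open>b\<close>, its right leg iff \<open>\<not> b\<close>.
    \<^item> \<open>LMin\<close> is a local minimum.
    \<^item> \<open>Cross c\<close> is a crossing of two adjacent strands; the overcrossing strand runs from top right
      to bottom left iff \<open>c\<close>, from top left to bottom right iff \<open>\<not> c\<close>.  If both strands point
      downwards, the crossing is thus positive iff \<open>c\<close>.\<close>

datatype piece = LMax bool | LMin | Cross bool

type_synonym diagram = "(nat \<times> piece) list"

text \<open>Effect of a slice on the list of the directions of the strands at a given height
  (\<open>True\<close> for downwards); \<open>None\<close> if the slice does not fit.\<close>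

fun slice_step :: "nat \<times> piece \<Rightarrow> bool list \<Rightarrow> bool list option" where
  "slice_step (p, LMax b) s =
     (if p \<le> length s then Some (take p s @ [b, \<not> b] @ drop p s) else None)"
| "slice_step (p, LMin) s =
     (if p + 1 < length s \<and> s ! p \<noteq> s ! (p + 1) then Some (take p s @ drop (p + 2) s) else None)"
| "slice_step (p, Cross c) s =
     (if p + 1 < length s then Some (take p s @ [s ! (p + 1), s ! p] @ drop (p + 2) s) else None)"

fun run_slices :: "diagram \<Rightarrow> bool list \<Rightarrow> bool list option" where
  "run_slices [] s = Some s"
| "run_slices (x # D) s = Option.bind (slice_step x s) (run_slices D)"

definition link_diagram :: "diagram \<Rightarrow> bool" where
  "link_diagram D \<longleftrightarrow> run_slices D [] = Some []"

fun upper_ends :: "piece \<Rightarrow> nat" where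
  "upper_ends (LMax b) = 0"
| "upper_ends LMin = 2"
| "upper_ends (Cross c) = 2"

fun lower_ends :: "piece \<Rightarrow> nat" where
  "lower_ends (LMax b) = 2"
| "lower_ends LMin = 0"
| "lower_ends (Cross c) = 2"

text \<open>The Reidemeister moves together with the moves generating planar isotopy.  The rule
  \<open>exchange\<close> interchanges the heights of two pieces that are side by side, e strands apart.  The
  condition in \<open>R3\<close> says that the three strands do not overcross each other cyclically.\<close>

inductive diagram_move :: "diagram \<Rightarrow> diagram \<Rightarrow> bool" where
  exchange: "diagram_move [(p, s), (p + lower_ends s + e, t)] [(p + upper_ends s + e, t), (p, s)]"
| zigzag_left: "diagram_move [(p, LMax b), (Suc p, LMin)] []"
| zigzag_right: "diagram_move [(Suc p, LMax b), (p, LMin)] []"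
| slide_max: "diagram_move [(p, LMax b), (Suc p, Cross c)] [(Suc p, LMax b), (p, Cross (\<not> c))]"
| slide_min: "diagram_move [(p, Cross c), (Suc p, LMin)] [(Suc p, Cross (\<not> c)), (p, LMin)]"
| R1_max: "diagram_move [(p, LMax b), (p, Cross c)] [(p, LMax (\<not> b))]"
| R1_min: "diagram_move [(p, Cross c), (p, LMin)] [(p, LMin)]"
| R2: "diagram_move [(p, Cross c), (p, Cross (\<not> c))] []"
| R3: "b = a \<or> b = c \<Longrightarrow>
    diagram_move [(p, Cross a), (Suc p, Cross b), (p, Cross c)]
                 [(Suc p, Cross c), (p, Cross b), (Suc p, Cross a)]"

inductive isotopic :: "diagram \<Rightarrow> diagram \<Rightarrow> bool" where
  refl: "link_diagram D \<Longrightarrow> isotopic D D"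
| sym: "isotopic D E \<Longrightarrow> isotopic E D"
| trans: "isotopic D E \<Longrightarrow> isotopic E F \<Longrightarrow> isotopic D F"
| move: "diagram_move l r \<Longrightarrow> link_diagram (u @ l @ v) \<Longrightarrow> link_diagram (u @ r @ v) \<Longrightarrow>
    isotopic (u @ l @ v) (u @ r @ v)"

quotient_type oriented_link = diagram / partial: isotopic
proof (rule part_equivpI)
  show "\<exists>D. isotopic D D"
    by (rule exI[of _ "[]"]) (simp add: isotopic.refl link_diagram_def)
  show "symp isotopic" by (auto intro: sympI isotopic.sym)
  show "transp isotopic" by (auto intro: transpI isotopic.trans)
qed

text \<open>The closure of a braid: its strands, directed downwards, are joined at the right by nested
  arcs; words are read from top to bottom.\<close>

definition closure_diagram :: "nat \<Rightarrow> braid_word \<Rightarrow> diagram" where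
  "closure_diagram n w =
     map (\<lambda>p. (p, LMax True)) [0..<n] @ map (\<lambda>(i, b). (i - 1, Cross b)) w
     @ map (\<lambda>p. (p, LMin)) (rev [0..<n])"

definition braid_closure :: "nat \<Rightarrow> braid \<Rightarrow> oriented_link" where
  "braid_closure n \<xi> = abs_oriented_link (closure_diagram n (some_word \<xi>))"

text \<open>The common value of the braid invariant on all braids with closure \<open>L\<close>.\<close>

definition link_invariant ::
  "nat \<Rightarrow> nat \<Rightarrow> nat \<Rightarrow> complex mat \<times> complex mat \<times> complex \<times> complex \<Rightarrow> oriented_link \<Rightarrow> complex"
  where
  "link_invariant d k m S L =
     (THE t. \<exists>n\<ge>1. \<exists>\<xi>\<in>carrier (braid_group n).
        braid_closure n \<xi> = L \<and> t = braid_invariant d k m S n \<xi>)"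

definition skein_triple :: "oriented_link \<Rightarrow> oriented_link \<Rightarrow> oriented_link \<Rightarrow> bool" where
  "skein_triple Lm L0 Lp \<longleftrightarrow>
     (\<exists>n\<ge>2. \<exists>\<xi>\<in>carrier (braid_group n).
        L0 = braid_closure n \<xi> \<and>
        Lp = braid_closure n (braid_gen n 1 \<otimes>\<^bsub>braid_group n\<^esub> \<xi>) \<and>
        Lm = braid_closure n (inv\<^bsub>braid_group n\<^esub> (braid_gen n 1) \<otimes>\<^bsub>braid_group n\<^esub> \<xi>))"

text \<open>The trivial link: n disjoint unnested circles.\<close>

definition trivial_link :: "nat \<Rightarrow> oriented_link" where
  "trivial_link n = abs_oriented_link (concat (replicate n [(0, LMax True), (0, LMin)]))"


section \<open>The operator of type I\<close>

definition R_typeI :: "real \<Rightarrow> complex mat" where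
  "R_typeI \<theta> = diag_block_mat
     [complex_of_real (1 / sqrt 2) \<cdot>\<^sub>m mat_of_rows_list 4
        [[1, 0, 1, 0],
         [0, \<i>, 0, exp (\<i> * \<theta>)],
         [- \<i>, 0, \<i>, 0],
         [0, - \<i> * exp (- \<i> * \<theta>), 0, 1]],
      complex_of_real (1 / sqrt 2) \<cdot>\<^sub>m mat_of_rows_list 4
        [[\<i>, 0, exp (\<i> * \<theta>), 0],
         [0, 1, 0, - exp (2 * \<i> * \<theta>)],
         [- \<i> * exp (- \<i> * \<theta>), 0, 1, 0],
         [0, \<i> * exp (- 2 * \<i> * \<theta>), 0, \<i>]]]"

end

theory Submission
  imports Defs
begin

text \<open>
  The operator R acts on three neighbouring tensor factors, fixes the two outer basis indices and
  changes the middle one.  So a basis vector of the tensor power on which n-strand braids act is a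
  colouring by \<open>False\<close>, \<open>True\<close> of the \<open>n + 1\<close> regions into which n parallel strands cut the plane,
  and an entry of \<open>\<alpha>\<^sup>-\<^sup>1 R\<close> is a weight attached to a crossing and to the colours of the four regions
  around it.  Named by their position relative to the direction of travel (behind, ahead, at the two
  sides), these four regions make sense for a crossing in any position, whatever the directions of
  its strands on the page.  Every oriented diagram then has a state sum: the sum over all colourings
  of its regions of the product of the weights of its crossings, where maxima and minima have
  weight 1.

  This state sum is invariant under all diagram moves (\<open>diagram_move_op\<close>).  Sliding a crossing past
  a maximum or minimum only renames its four regions (\<open>crossing_weight_rotate\<close>); the Reidemeister
  moves are the identities \<open>crossing_weight_R1\<close>, \<open>crossing_weight_R2\<close> and \<open>crossing_weight_R3\<close>
  between sums over the colour of a region that exists on one side of the move only.  All weights are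
  \<open>(1 - \<i>) / 2\<close> times a power of \<open>\<i>\<close> and a power of \<open>z = exp (\<i> \<theta>)\<close>.  The powers of z are a product
  over the four ends of the strands at the crossing and cancel along each strand, so they affect
  none of these identities, and what remains is a finite check on fourth roots of unity.

  In the closure of a braid the arcs on the right force the colours there to mirror those on the
  left, and summing over all colourings is taking the trace.  Hence the state sum of the closure is
  the braid invariant (\<open>diagram_value_closure\<close>, \<open>braid_invariant_eq\<close>), which therefore depends only
  on the isotopy class of the closure.  Both the Yang-Baxter equations for R and the fact that the
  closure depends only on the braid come from moves between crossings of downward strands.

  The skein relation holds because the positive and the negative weight add up to the identity,
  \<open>\<alpha>\<^sup>-\<^sup>1 R + \<alpha> R\<^sup>-\<^sup>1 = 1\<close>.  A trivial n-component link has \<open>n + 1\<close> regions and no crossings, so its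
  state sum is \<open>2\<^sup>n\<^sup>+\<^sup>1\<close>.  The perpendicularity conditions hold because braids never change the colour
  of the last region, whereas \<open>Sp(R) - \<alpha> 1\<close> and \<open>Sp(R\<^sup>-\<^sup>1) - \<alpha>\<^sup>-\<^sup>1 1\<close> have entries only where this
  colour changes.
\<close>

section \<open>Crossing weights\<close>

text \<open>A crossing weight without its factor \<open>(1 - \<i>) / 2\<close> and its powers of z.  Both strands travel from
  the region coloured i to the region coloured j, passing between the regions coloured l and r at
  their sides.  In tensor terms, i is the middle row index and j the middle column index of the
  operator, and l, r are the two outer indices.\<close>

definition turn :: "bool \<Rightarrow> bool \<Rightarrow> bool \<Rightarrow> bool \<Rightarrow> bool \<Rightarrow> complex" where
  "turn pos i j l r =
     (if i = j then (if pos = (i = (l = r)) then \<i> else 1)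
      else (if pos = (l \<and> r) then - 1 else 1) * (if j then 1 else - \<i>))"

text \<open>The crossing \<open>Cross c\<close> has incoming upper strands with directions d (left) and e (right) and is
  surrounded by the regions a (left), b (top), b' (bottom) and a' (right).  Reversing one of the two
  strands changes the sign of the crossing, which is the reason for \<open>\<not> c\<close>.\<close>

definition crossing_phase :: "bool \<Rightarrow> bool \<Rightarrow> bool \<Rightarrow> bool \<Rightarrow> bool \<Rightarrow> bool \<Rightarrow> bool \<Rightarrow> complex" where
  "crossing_phase c d e a b b' a' =
     (if d = e then (if d then turn c b b' a a' else turn c b' b a a')
      else (if d then turn (\<not> c) a a' b b' else turn (\<not> c) a' a b b'))"

text \<open>The factor of an end of a strand with direction d between regions a and b.  It is symmetric in a and
  b and inverted by reversing d, so the two legs of a maximum or minimum cancel.\<close>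

definition edge :: "complex \<Rightarrow> bool \<Rightarrow> bool \<Rightarrow> bool \<Rightarrow> complex" where
  "edge z d a b = (if a \<and> b then (if d then z else 1 / z) else 1)"

definition crossing_weight ::
  "complex \<Rightarrow> bool \<Rightarrow> bool \<Rightarrow> bool \<Rightarrow> bool \<Rightarrow> bool \<Rightarrow> bool \<Rightarrow> bool \<Rightarrow> complex" where
  "crossing_weight z c d e a b b' a' = (1 - \<i>) / 2 * crossing_phase c d e a b b' a' *
     (edge z e a b' * edge z d b' a' / (edge z d a b * edge z e b a'))"

lemma edge_nonzero [simp]: "z \<noteq> 0 \<Longrightarrow> edge z d a b \<noteq> 0"
  by (simp add: edge_def)

lemma crossing_phase_R2:
  "(\<Sum>x\<in>UNIV. crossing_phase c d e a b x a' * crossing_phase (\<not> c) e d a x b' a') =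
     (if b = b' then 2 * \<i> else 0)"
proof -
  have "\<forall>c d e a b a' b'. (\<Sum>x\<in>UNIV. crossing_phase c d e a b x a' * crossing_phase (\<not> c) e d a x b' a') =
     (if b = b' then 2 * \<i> else 0)"
    unfolding all_bool_eq by (simp add: UNIV_bool crossing_phase_def turn_def)
  then show ?thesis by blast
qed

lemma crossing_weight_R2:
  assumes "z \<noteq> 0"
  shows "(\<Sum>x\<in>UNIV. crossing_weight z c d e a b x a' * crossing_weight z (\<not> c) e d a x b' a') =
    of_bool (b = b')"
proof -
  define g where "g = edge z d a b' * edge z e b' a' / (edge z d a b * edge z e b a')"
  have "crossing_weight z c d e a b x a' * crossing_weight z (\<not> c) e d a x b' a' =
      ((1 - \<i>) / 2) ^ 2 * g * (crossing_phase c d e a b x a' * crossing_phase (\<not> c) e d a x b' a')" for x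
    using assms by (simp add: crossing_weight_def g_def power2_eq_square)
  then have "(\<Sum>x\<in>UNIV. crossing_weight z c d e a b x a' * crossing_weight z (\<not> c) e d a x b' a') =
      ((1 - \<i>) / 2) ^ 2 * g * (if b = b' then 2 * \<i> else 0)"
    by (simp only: sum_distrib_left [symmetric] crossing_phase_R2)
  moreover have "((1 - \<i>) / 2) ^ 2 * (2 * \<i>) = 1"
    by (simp add: power2_eq_square field_simps)
  moreover have "g = 1" if "b = b'"
    using assms that by (simp add: g_def)
  ultimately show ?thesis by auto
qed

lemma crossing_phase_R1:
  "(\<Sum>b\<in>UNIV. crossing_phase c d (\<not> d) a b b' a) = 1 + \<i>"
  "(\<Sum>b'\<in>UNIV. crossing_phase c d (\<not> d) a b b' a) = 1 + \<i>"
  by (cases c; cases d; cases a; cases b; cases b'; simp add: UNIV_bool crossing_phase_def turn_def)+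

lemma crossing_weight_R1:
  assumes "z \<noteq> 0"
  shows "(\<Sum>b\<in>UNIV. crossing_weight z c d (\<not> d) a b b' a) = 1" (is ?top)
    and "(\<Sum>b'\<in>UNIV. crossing_weight z c d (\<not> d) a b b' a) = 1" (is ?bottom)
proof -
  have *: "crossing_weight z c d (\<not> d) a b b' a = (1 - \<i>) / 2 * crossing_phase c d (\<not> d) a b b' a" for b b'
    using assms by (auto simp: crossing_weight_def edge_def)
  have **: "(1 - \<i>) / 2 * (1 + \<i>) = 1" by (simp add: field_simps)
  show ?top ?bottom
    by (simp_all only: * sum_distrib_left [symmetric] crossing_phase_R1 **)
qed

lemma turn_commute: "turn pos i j l r = turn pos i j r l"
  by (auto simp: turn_def)

text \<open>A quarter turn of the page turns one configuration into the other; the four regions keep their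
  places relative to the direction of travel.\<close>

lemma crossing_weight_rotate:
  assumes "z \<noteq> 0"
  shows "crossing_weight z c (\<not> d) e a b b' a' = crossing_weight z (\<not> c) e d b a' a b'"
proof -
  have "crossing_phase c (\<not> d) e a b b' a' = crossing_phase (\<not> c) e d b a' a b'"
    by (cases d; cases e; simp add: crossing_phase_def turn_commute)
  moreover have "edge z e a b' * edge z (\<not> d) b' a' / (edge z (\<not> d) a b * edge z e b a') =
      edge z d b a * edge z e a b' / (edge z e b a' * edge z d a' b')"
    using assms by (cases d; cases e; simp add: edge_def)
  ultimately show ?thesis by (simp add: crossing_weight_def)
qed

lemma crossing_weight_skein:
  assumes "z \<noteq> 0"
  shows "crossing_weight z True True True a b b' a' + crossing_weight z False True True a b b' a' =
    of_bool (b = b')"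
proof -
  have "crossing_phase True True True a b b' a' + crossing_phase False True True a b b' a' =
      (if b = b' then 1 + \<i> else 0)"
    by (cases a; cases b; cases b'; cases a'; simp add: crossing_phase_def turn_def)
  moreover have "(1 - \<i>) / 2 * (1 + \<i>) = 1" by (simp add: field_simps)
  ultimately show ?thesis
    using assms
    by (cases "b = b'") (simp_all only: crossing_weight_def ring_distribs [symmetric], simp_all)
qed

text \<open>Together with \<open>crossing_phase_simps\<close>, a table that lets the simplifier evaluate phases without
  unfolding nested conditionals, which keeps the large case distinction below fast.\<close>

lemma turn_simps:
  "turn True True True l r = (if l = r then \<i> else 1)"
  "turn False True True l r = (if l = r then 1 else \<i>)"
  "turn True False False l r = (if l = r then 1 else \<i>)"
  "turn False False False l r = (if l = r then \<i> else 1)"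
  "turn True False True l r = (if l \<and> r then - 1 else 1)"
  "turn False False True l r = (if l \<and> r then 1 else - 1)"
  "turn True True False l r = (if l \<and> r then \<i> else - \<i>)"
  "turn False True False l r = (if l \<and> r then - \<i> else \<i>)"
  by (auto simp: turn_def)

lemma crossing_phase_simps:
  "crossing_phase c True True a b b' a' = turn c b b' a a'"
  "crossing_phase c False False a b b' a' = turn c b' b a a'"
  "crossing_phase c True False a b b' a' = turn (\<not> c) a a' b b'"
  "crossing_phase c False True a b b' a' = turn (\<not> c) a' a b b'"
  by (auto simp: crossing_phase_def)

lemma sum_bool: "(\<Sum>m\<in>UNIV. f m) = f False + f True"
  by (simp add: UNIV_bool)

text \<open>The three strands cut the plane into six outer regions and one inner one; m is the colour of the
  inner region before and after the move.  With 3 directions, 6 outer colours and 6 admissible types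
  of crossings there are 3072 identities between sums of two fourth roots of unity.\<close>

lemma crossing_phase_R3:
  assumes "y = x \<or> y = w"
  shows "(\<Sum>m\<in>UNIV. crossing_phase x d1 d2 a0 a1 m a2 * crossing_phase y d1 d3 m a2 b2 a3
             * crossing_phase w d2 d3 a0 m b1 b2) =
         (\<Sum>m\<in>UNIV. crossing_phase w d2 d3 a1 a2 m a3 * crossing_phase y d1 d3 a0 a1 b1 m
             * crossing_phase x d1 d2 b1 m b2 a3)"
proof -
  define P where "P x y w \<longleftrightarrow> (\<forall>d1 d2 d3 a0 a1 a2 a3 b1 b2.
    (\<Sum>m\<in>UNIV. crossing_phase x d1 d2 a0 a1 m a2 * crossing_phase y d1 d3 m a2 b2 a3
             * crossing_phase w d2 d3 a0 m b1 b2) =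
         (\<Sum>m\<in>UNIV. crossing_phase w d2 d3 a1 a2 m a3 * crossing_phase y d1 d3 a0 a1 b1 m
             * crossing_phase x d1 d2 b1 m b2 a3))" for x y w
  note finite_check = sum_bool crossing_phase_simps turn_simps simp_thms if_True if_False
  have "P True True True"
    unfolding P_def all_bool_eq by (simp only: finite_check, simp)
  moreover have "P True True False"
    unfolding P_def all_bool_eq by (simp only: finite_check, simp)
  moreover have "P False True True"
    unfolding P_def all_bool_eq by (simp only: finite_check, simp)
  moreover have "P True False False"
    unfolding P_def all_bool_eq by (simp only: finite_check, simp)
  moreover have "P False False True"
    unfolding P_def all_bool_eq by (simp only: finite_check, simp)
  moreover have "P False False False"
    unfolding P_def all_bool_eq by (simp only: finite_check, simp)
  ultimately have "P x y w"
    using assms by (cases x; cases y; cases w; simp)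
  then show ?thesis by (simp add: P_def)
qed

lemma crossing_weight_R3:
  assumes "z \<noteq> 0" "y = x \<or> y = w"
  shows "(\<Sum>m\<in>UNIV. crossing_weight z x d1 d2 a0 a1 m a2 * crossing_weight z y d1 d3 m a2 b2 a3
             * crossing_weight z w d2 d3 a0 m b1 b2) =
         (\<Sum>m\<in>UNIV. crossing_weight z w d2 d3 a1 a2 m a3 * crossing_weight z y d1 d3 a0 a1 b1 m
             * crossing_weight z x d1 d2 b1 m b2 a3)"
proof -
  \<comment> \<open>The edge factors at the inner region occur once in a numerator and once in a denominator, so
    that g involves only the outer regions.\<close>
  define g where "g = ((1 - \<i>) / 2) ^ 3 * (edge z d3 a0 b1 * edge z d2 b1 b2 * edge z d1 b2 a3 /
    (edge z d1 a0 a1 * edge z d2 a1 a2 * edge z d3 a2 a3))"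
  have L: "crossing_weight z x d1 d2 a0 a1 m a2 * crossing_weight z y d1 d3 m a2 b2 a3
             * crossing_weight z w d2 d3 a0 m b1 b2 =
      g * (crossing_phase x d1 d2 a0 a1 m a2 * crossing_phase y d1 d3 m a2 b2 a3
             * crossing_phase w d2 d3 a0 m b1 b2)" for m
    using assms(1) by (simp add: crossing_weight_def g_def power3_eq_cube mult_ac)
  have R: "crossing_weight z w d2 d3 a1 a2 m a3 * crossing_weight z y d1 d3 a0 a1 b1 m
             * crossing_weight z x d1 d2 b1 m b2 a3 =
      g * (crossing_phase w d2 d3 a1 a2 m a3 * crossing_phase y d1 d3 a0 a1 b1 m
             * crossing_phase x d1 d2 b1 m b2 a3)" for m
    using assms(1) by (simp add: crossing_weight_def g_def power3_eq_cube mult_ac)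
  show ?thesis
    unfolding L R sum_distrib_left [symmetric] crossing_phase_R3 [OF assms(2)] ..
qed

section \<open>Isotopies of parts of diagrams and braid closures\<close>

lemma run_slices_append: "run_slices (D @ E) s = Option.bind (run_slices D s) (run_slices E)"
  by (induction D arbitrary: s) (simp_all split: bind_split)

lemma split_list_1: "p < length xs \<Longrightarrow> \<exists>u a v. xs = u @ a # v \<and> length u = p"
  by (metis id_take_nth_drop length_take min.absorb4)

text \<open>Isotopies of complete diagrams are assembled from such replacements.  The first conjunct makes sure
  that the surrounding diagram still fits after the replacement.\<close>

definition local_isotopy :: "bool list \<Rightarrow> diagram \<Rightarrow> diagram \<Rightarrow> bool" where
  "local_isotopy s D E \<longleftrightarrow> run_slices D s = run_slices E s \<and>
     (\<forall>u v. run_slices u [] = Some s \<longrightarrow> link_diagram (u @ D @ v) \<longrightarrow> isotopic (u @ D @ v) (u @ E @ v))"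

lemma local_isotopy_refl [simp]: "local_isotopy s D D"
  by (simp add: local_isotopy_def isotopic.refl)

lemma link_diagram_replace:
  assumes "run_slices D s = run_slices E s" "run_slices u [] = Some s" "link_diagram (u @ D @ v)"
  shows "link_diagram (u @ E @ v)"
  using assms by (simp add: link_diagram_def run_slices_append)

lemma local_isotopy_sym:
  assumes "local_isotopy s D E" shows "local_isotopy s E D"
proof -
  have "isotopic (u @ E @ v) (u @ D @ v)"
    if "run_slices u [] = Some s" "link_diagram (u @ E @ v)" for u v
    using that assms link_diagram_replace [of E s D u v]
    by (intro isotopic.sym [of "u @ D @ v"]) (simp add: local_isotopy_def)
  with assms show ?thesis by (simp add: local_isotopy_def)
qed

lemma local_isotopy_trans [trans]:
  assumes "local_isotopy s D E" "local_isotopy s E F" shows "local_isotopy s D F"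
proof -
  have "isotopic (u @ D @ v) (u @ F @ v)"
    if "run_slices u [] = Some s" "link_diagram (u @ D @ v)" for u v
  proof (rule isotopic.trans)
    show "isotopic (u @ D @ v) (u @ E @ v)"
      using that assms(1) by (simp add: local_isotopy_def)
    show "isotopic (u @ E @ v) (u @ F @ v)"
      using that assms link_diagram_replace [of D s E u v] by (simp add: local_isotopy_def)
  qed
  with assms show ?thesis by (simp add: local_isotopy_def)
qed

lemma local_isotopy_move:
  assumes "diagram_move l r" "run_slices l s = run_slices r s" shows "local_isotopy s l r"
proof -
  have "isotopic (u @ l @ v) (u @ r @ v)"
    if "run_slices u [] = Some s" "link_diagram (u @ l @ v)" for u v
    using that assms link_diagram_replace [of l s r u v] by (intro isotopic.move)
  with assms show ?thesis by (simp add: local_isotopy_def)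
qed

lemma local_isotopy_context:
  assumes "run_slices u s = Some s'" "local_isotopy s' D E"
  shows "local_isotopy s (u @ D @ v) (u @ E @ v)"
proof -
  have "isotopic (u' @ (u @ D @ v) @ v') (u' @ (u @ E @ v) @ v')"
    if "run_slices u' [] = Some s" "link_diagram (u' @ (u @ D @ v) @ v')" for u' v'
  proof -
    have "run_slices (u' @ u) [] = Some s'"
      using that assms(1) by (simp add: run_slices_append)
    moreover have "link_diagram ((u' @ u) @ D @ (v @ v'))"
      using that(2) by simp
    ultimately have "isotopic ((u' @ u) @ D @ (v @ v')) ((u' @ u) @ E @ (v @ v'))"
      using assms(2) unfolding local_isotopy_def by blast
    then show ?thesis by simp
  qed
  with assms show ?thesis
    by (simp add: local_isotopy_def run_slices_append)
qed

lemma isotopic_if_local_isotopy: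
  "local_isotopy [] D E \<Longrightarrow> link_diagram D \<Longrightarrow> isotopic D E"
  unfolding local_isotopy_def by (metis append_Nil append_Nil2 run_slices.simps(1))

definition closing_maxima :: "nat \<Rightarrow> diagram" where
  "closing_maxima n = map (\<lambda>p. (p, LMax True)) [0..<n]"

definition closing_minima :: "nat \<Rightarrow> diagram" where
  "closing_minima n = map (\<lambda>p. (p, LMin)) (rev [0..<n])"

definition crossings :: "braid_word \<Rightarrow> diagram" where
  "crossings w = map (\<lambda>(i, b). (i - 1, Cross b)) w"

lemma crossings_simps [simp]: "crossings [] = []"
  "crossings ((i, b) # w) = (i - 1, Cross b) # crossings w"
  "crossings (u @ w) = crossings u @ crossings w"
  by (simp_all add: crossings_def)

lemma closure_diagram_eq: "closure_diagram n w = closing_maxima n @ crossings w @ closing_minima n"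
  by (simp add: closure_diagram_def closing_maxima_def closing_minima_def crossings_def)

abbreviation closure_strands :: "nat \<Rightarrow> bool list" where
  "closure_strands n \<equiv> replicate n True @ replicate n False"

lemma closing_minima_Suc: "closing_minima (Suc n) = (n, LMin) # closing_minima n"
  by (simp add: closing_minima_def)

lemma closing_maxima_Suc: "closing_maxima (Suc n) = closing_maxima n @ [(n, LMax True)]"
  by (simp add: closing_maxima_def)

lemma closing_0 [simp]: "closing_maxima 0 = []" "closing_minima 0 = []"
  by (simp_all add: closing_maxima_def closing_minima_def)

lemma closure_strands_Suc: "replicate n True @ True # False # replicate n False = closure_strands (Suc n)"
  by (simp flip: replicate_append_same)

lemma run_closing_maxima: "run_slices (closing_maxima n) [] = Some (closure_strands n)"
  by (induction n) (simp_all add: closing_maxima_Suc run_slices_append closure_strands_Suc)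

lemma step_closing_minimum: "slice_step (n, LMin) (closure_strands (Suc n)) = Some (closure_strands n)"
  unfolding closure_strands_Suc [symmetric] by (simp add: nth_append Suc_diff_le)

lemma run_closing_minima: "run_slices (closing_minima n) (closure_strands n) = Some []"
  by (induction n) (simp_all only: closing_minima_Suc run_slices.simps step_closing_minimum, simp_all)

lemma braid_words_Cons: "(i, b) # w \<in> braid_words n \<longleftrightarrow> 1 \<le> i \<and> i < n \<and> w \<in> braid_words n"
  by (auto simp: braid_words_def)

lemma braid_words_append: "u @ w \<in> braid_words n \<longleftrightarrow> u \<in> braid_words n \<and> w \<in> braid_words n"
  by (auto simp: braid_words_def)

lemma braid_words_Nil [simp]: "[] \<in> braid_words n"
  by (simp add: braid_words_def)

lemma step_parallel_crossing:
  assumes "i < n" "Suc 0 \<le> i"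
  shows "slice_step (i - Suc 0, Cross c) (replicate n True @ s) = Some (replicate n True @ s)"
proof -
  have "n = (i - Suc 0) + Suc (Suc (n - Suc i))" using assms by simp
  then have *: "replicate n True =
      replicate (i - Suc 0) True @ True # True # replicate (n - Suc i) True"
    by (metis replicate_add replicate_Suc)
  show ?thesis unfolding * by (simp add: nth_append Suc_diff_le)
qed

lemma run_crossings:
  "w \<in> braid_words n \<Longrightarrow> run_slices (crossings w) (replicate n True @ s) = Some (replicate n True @ s)"
proof (induction w)
  case (Cons k w)
  then show ?case
    by (cases k) (simp add: braid_words_Cons step_parallel_crossing del: slice_step.simps)
qed simp

lemma link_diagram_closure: "w \<in> braid_words n \<Longrightarrow> link_diagram (closure_diagram n w)"
  by (simp add: link_diagram_def closure_diagram_eq run_slices_append run_closing_maxima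
      run_crossings run_closing_minima)

lemma isotopic_closure_if_move:
  assumes "diagram_move (crossings l) (crossings r)" "u @ l @ v \<in> braid_words n" "u @ r @ v \<in> braid_words n"
  shows "isotopic (closure_diagram n (u @ l @ v)) (closure_diagram n (u @ r @ v))"
  using isotopic.move [OF assms(1), of "closing_maxima n @ crossings u" "crossings v @ closing_minima n"]
    link_diagram_closure [OF assms(2)] link_diagram_closure [OF assms(3)]
  by (simp add: closure_diagram_eq)

lemma braid_eq_words: "braid_eq n u v \<Longrightarrow> u \<in> braid_words n \<and> v \<in> braid_words n"
  by (induction rule: braid_eq.induct) (auto simp: braid_words_append braid_words_Cons)

text \<open>Each defining relation of the braid group is a Reidemeister move or an exchange of heights.\<close>

lemma braid_eq_isotopic:
  "braid_eq n u v \<Longrightarrow> isotopic (closure_diagram n u) (closure_diagram n v)"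
proof (induction rule: braid_eq.induct)
  case (cancel u i b v)
  then show ?case
    using isotopic_closure_if_move [of "[(i, b), (i, \<not> b)]" "[]" u v n] diagram_move.R2
    by (simp add: braid_words_append braid_words_Cons)
next
  case (far u i j v)
  then have "0 < i"
    by (simp add: braid_words_append braid_words_Cons)
  then obtain q where "i = Suc q"
    by (cases i) simp_all
  moreover obtain e where "j = i + 2 + e"
    using far(2) le_Suc_ex by blast
  ultimately have ij: "i = Suc q" "j = Suc (q + 2 + e)"
    by simp_all
  have "diagram_move (crossings [(i, True), (j, True)]) (crossings [(j, True), (i, True)])"
    unfolding ij using diagram_move.exchange [of q "Cross True" e "Cross True"] by simp
  with far show ?case
    using isotopic_closure_if_move [of "[(i, True), (j, True)]" "[(j, True), (i, True)]" u v n]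
    by (simp add: braid_words_append braid_words_Cons)
next
  case (braid u i v)
  then have "Suc i - 1 = Suc (i - 1)"
    by (simp add: braid_words_append braid_words_Cons)
  then have "diagram_move (crossings [(i, True), (Suc i, True), (i, True)])
      (crossings [(Suc i, True), (i, True), (Suc i, True)])"
    using diagram_move.R3 [of True True True "i - 1"] by simp
  with braid show ?case
    using isotopic_closure_if_move [of "[(i, True), (Suc i, True), (i, True)]"
      "[(Suc i, True), (i, True), (Suc i, True)]" u v n]
    by (simp add: braid_words_append braid_words_Cons)
next
  case (sym u v)
  then show ?case by (blast intro: isotopic.sym)
next
  case (trans u v w)
  then show ?case by (blast intro: isotopic.trans)
qed (simp add: isotopic.refl link_diagram_closure)

section \<open>The braid group\<close>

lemma braid_class_eq: "braid_eq n u v \<Longrightarrow> braid_class n u = braid_class n v"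
  unfolding braid_class_def by (blast intro: braid_eq.sym braid_eq.trans)

lemma some_word_class:
  assumes "u \<in> braid_words n"
  shows "braid_eq n u (some_word (braid_class n u))"
proof -
  have "u \<in> braid_class n u" using assms by (simp add: braid_class_def braid_eq.refl)
  then have "some_word (braid_class n u) \<in> braid_class n u"
    unfolding some_word_def by (rule someI)
  then show ?thesis by (simp add: braid_class_def)
qed

lemma braid_eq_context:
  assumes "braid_eq n u v" "a @ b \<in> braid_words n"
  shows "braid_eq n (a @ u @ b) (a @ v @ b)"
  using assms(1)
proof (induction rule: braid_eq.induct)
  case (cancel u i c v)
  then show ?case
    using assms(2) braid_eq.cancel [of "a @ u" i c "v @ b" n]
    by (simp add: braid_words_append braid_words_Cons)
next
  case (far u i j v)
  then show ?case
    using assms(2) braid_eq.far [of "a @ u" i j "v @ b" n]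
    by (simp add: braid_words_append braid_words_Cons)
next
  case (braid u i v)
  then show ?case
    using assms(2) braid_eq.braid [of "a @ u" i "v @ b" n]
    by (simp add: braid_words_append braid_words_Cons)
next
  case (sym u v)
  then show ?case by (blast intro: braid_eq.sym)
next
  case (trans u v w)
  then show ?case by (blast intro: braid_eq.trans)
next
  case (refl u)
  then show ?case using assms(2) by (simp add: braid_eq.refl braid_words_append)
qed

lemma braid_eq_append:
  assumes "braid_eq n u u'" "braid_eq n v v'"
  shows "braid_eq n (u @ v) (u' @ v')"
proof -
  have "braid_eq n (u @ v) (u' @ v)"
    using braid_eq_context [OF assms(1), of "[]" v] braid_eq_words [OF assms(2)] by simp
  also have "braid_eq n (u' @ v) (u' @ v')"
    using braid_eq_context [OF assms(2), of u' "[]"] braid_eq_words [OF assms(1)] by simp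
  finally (braid_eq.trans) show ?thesis .
qed

lemma braid_group_mult:
  assumes "u \<in> braid_words n" "v \<in> braid_words n"
  shows "braid_class n u \<otimes>\<^bsub>braid_group n\<^esub> braid_class n v = braid_class n (u @ v)"
proof -
  have "braid_class n (u' @ v') = braid_class n (u @ v)"
    if "u' \<in> braid_class n u" "v' \<in> braid_class n v" for u' v'
  proof -
    from that have "braid_eq n u u'" "braid_eq n v v'"
      by (simp_all add: braid_class_def)
    then show ?thesis
      by (intro braid_class_eq [symmetric] braid_eq_append)
  qed
  moreover have "u \<in> braid_class n u" "v \<in> braid_class n v"
    using assms by (simp_all add: braid_class_def braid_eq.refl)
  ultimately have "(\<Union>u'\<in>braid_class n u. \<Union>v'\<in>braid_class n v. braid_class n (u' @ v')) =
      braid_class n (u @ v)"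
    by blast
  then show ?thesis
    by (simp add: braid_group_def)
qed

lemma carrier_braid_group: "carrier (braid_group n) = braid_class n ` braid_words n"
  by (simp add: braid_group_def)

lemma one_braid_group: "\<one>\<^bsub>braid_group n\<^esub> = braid_class n []"
  by (simp add: braid_group_def)

lemma monoid_braid_group: "monoid (braid_group n)"
  by (unfold_locales) (auto simp: carrier_braid_group one_braid_group braid_group_mult braid_words_append)

lemma inv_braid_gen:
  assumes "1 \<le> i" "i < n"
  shows "inv\<^bsub>braid_group n\<^esub> (braid_gen n i) = braid_class n [(i, False)]"
proof -
  have w: "[(i, b)] \<in> braid_words n" "[(i, b), (i, \<not> b)] \<in> braid_words n" for b
    using assms by (simp_all add: braid_words_Cons)
  have "braid_class n [(i, b)] \<otimes>\<^bsub>braid_group n\<^esub> braid_class n [(i, \<not> b)] = \<one>\<^bsub>braid_group n\<^esub>" for b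
    using braid_eq.cancel [of "[]" i b "[]" n] w
    by (simp add: braid_group_mult one_braid_group braid_class_eq)
  from this [of True] this [of False] show ?thesis
    using w monoid.inv_char [OF monoid_braid_group, of "braid_class n [(i, True)]" n "braid_class n [(i, False)]"]
    by (simp add: braid_gen_def carrier_braid_group)
qed

section \<open>The trivial link as a braid closure\<close>

abbreviation circle :: "nat \<Rightarrow> diagram" where
  "circle p \<equiv> [(p, LMax True), (p, LMin)]"

text \<open>One side of the circle is pushed across the strand by a second Reidemeister move; slides then move
  the maximum and the minimum to the other side, and a second Reidemeister move separates the circle
  from the strand again.\<close>

lemma circle_past_strand:
  assumes "q < length s"
  shows "local_isotopy s (circle (Suc q)) (circle q)"
proof -
  obtain s1 d s2 where s: "s = s1 @ d # s2" "length s1 = q"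
    using split_list_1 [OF assms] by blast
  note eval = s nth_append Suc_diff_le
  have "local_isotopy s (circle (Suc q))
      [(Suc q, LMax True), (q, Cross True), (q, Cross False), (Suc q, LMin)]"
  proof -
    have "local_isotopy (s1 @ [d, True, False] @ s2) [] [(q, Cross True), (q, Cross False)]"
      using s by (intro local_isotopy_sym [OF local_isotopy_move] diagram_move.R2 [of q True, simplified])
        (simp add: eval)
    from local_isotopy_context [OF _ this, of "[(Suc q, LMax True)]" s "[(Suc q, LMin)]"]
    show ?thesis by (simp add: eval)
  qed
  also have "local_isotopy s \<dots> [(q, LMax True), (Suc q, Cross False), (q, Cross False), (Suc q, LMin)]"
  proof -
    have "local_isotopy s [(Suc q, LMax True), (q, Cross True)] [(q, LMax True), (Suc q, Cross False)]"
      by (intro local_isotopy_sym [OF local_isotopy_move] diagram_move.slide_max [of q True False, simplified])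
        (simp add: eval)
    from local_isotopy_context [OF _ this, of "[]" s "[(q, Cross False), (Suc q, LMin)]"]
    show ?thesis by simp
  qed
  also have "local_isotopy s \<dots> [(q, LMax True), (Suc q, Cross False), (Suc q, Cross True), (q, LMin)]"
  proof -
    have "local_isotopy (s1 @ [True, d, False] @ s2) [(q, Cross False), (Suc q, LMin)] [(Suc q, Cross True), (q, LMin)]"
      by (intro local_isotopy_move diagram_move.slide_min [of q False, simplified])
        (simp add: eval)
    from local_isotopy_context [OF _ this, of "[(q, LMax True), (Suc q, Cross False)]" s "[]"]
    show ?thesis by (simp add: eval)
  qed
  also have "local_isotopy s \<dots> (circle q)"
  proof -
    have "local_isotopy (s1 @ [True, False, d] @ s2) [(Suc q, Cross False), (Suc q, Cross True)] []"
      by (intro local_isotopy_move diagram_move.R2 [of "Suc q" False, simplified])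
        (simp add: eval)
    from local_isotopy_context [OF _ this, of "[(q, LMax True)]" s "[(q, LMin)]"]
    show ?thesis by (simp add: eval)
  qed
  finally show ?thesis .
qed

lemma circle_to_left: "q \<le> length s \<Longrightarrow> local_isotopy s (circle q) (circle 0)"
proof (induction q)
  case (Suc q)
  have "local_isotopy s (circle (Suc q)) (circle q)"
    using Suc.prems by (intro circle_past_strand) simp
  also have "local_isotopy s (circle q) (circle 0)"
    using Suc.prems by (intro Suc.IH) simp
  finally show ?case .
qed simp

lemma maximum_past_circle:
  assumes "p \<le> length s"
  shows "local_isotopy s ((p, LMax b) # circle 0) (circle 0 @ [(p, LMax b)])"
proof -
  have "local_isotopy s [(p, LMax b), (0, LMax True)] [(0, LMax True), (Suc (Suc p), LMax b)]"
    using diagram_move.exchange [of 0 "LMax True" p "LMax b"] assms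
    by (intro local_isotopy_sym [OF local_isotopy_move]) simp_all
  from local_isotopy_context [OF _ this, of "[]" s "[(0, LMin)]"]
  have "local_isotopy s ((p, LMax b) # circle 0) [(0, LMax True), (Suc (Suc p), LMax b), (0, LMin)]"
    by simp
  also have "local_isotopy s \<dots> (circle 0 @ [(p, LMax b)])"
  proof -
    have "local_isotopy (True # False # s) [(Suc (Suc p), LMax b), (0, LMin)] [(0, LMin), (p, LMax b)]"
      using diagram_move.exchange [of 0 LMin p "LMax b"] assms
      by (intro local_isotopy_sym [OF local_isotopy_move]) simp_all
    from local_isotopy_context [OF _ this, of "[(0, LMax True)]" s "[]"]
    show ?thesis by simp
  qed
  finally show ?thesis .
qed

lemma maxima_past_circle: "local_isotopy [] (closing_maxima n @ circle 0) (circle 0 @ closing_maxima n)"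
proof (induction n)
  case (Suc n)
  have "local_isotopy [] (closing_maxima n @ ((n, LMax True) # circle 0) @ [])
      (closing_maxima n @ (circle 0 @ [(n, LMax True)]) @ [])"
    by (rule local_isotopy_context [OF run_closing_maxima maximum_past_circle]) simp
  also have "local_isotopy [] \<dots> (circle 0 @ closing_maxima (Suc n))"
    using local_isotopy_context [OF _ Suc, of "[]" "[]" "[(n, LMax True)]"]
    by (simp add: closing_maxima_Suc)
  finally show ?case by (simp add: closing_maxima_Suc)
qed simp

text \<open>The closure of the trivial braid consists of nested circles.  The innermost one can be moved out to
  the left of all maxima, that is, above the rest of the diagram.\<close>

lemma closure_identity_isotopic:
  "local_isotopy [] (closing_maxima n @ closing_minima n) (concat (replicate n (circle 0)))"
proof (induction n)
  case (Suc n)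
  have "local_isotopy [] (closing_maxima (Suc n) @ closing_minima (Suc n))
      (closing_maxima n @ circle 0 @ closing_minima n)"
    using local_isotopy_context [OF run_closing_maxima circle_to_left, of n n "closing_minima n"]
    by (simp add: closing_maxima_Suc closing_minima_Suc)
  also have "local_isotopy [] \<dots> (circle 0 @ closing_maxima n @ closing_minima n)"
    using local_isotopy_context [OF _ maxima_past_circle, of "[]" "[]" n "closing_minima n"] by simp
  also have "local_isotopy [] \<dots> (concat (replicate (Suc n) (circle 0)))"
    using local_isotopy_context [OF _ Suc, of "circle 0" "[]" "[]"] by simp
  finally show ?case .
qed simp

lemma closure_identity_trivial:
  "isotopic (closure_diagram n []) (concat (replicate n (circle 0)))"
  using isotopic_if_local_isotopy [OF closure_identity_isotopic] link_diagram_closure [of "[]" n]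
  by (simp add: closure_diagram_eq)

lemma trivial_link_closure: "trivial_link n = abs_oriented_link (closure_diagram n [])"
  unfolding trivial_link_def
  using Quotient_rel_abs [OF Quotient_oriented_link closure_identity_trivial] by (rule HOL.sym)

section \<open>The state sum of a diagram\<close>

text \<open>The state sum is evaluated from the bottom: a function \<open>\<phi>\<close> of the colours below a slice becomes a
  function of the colours x above it.  A maximum opens a new region, whose colour is summed over; a
  minimum joins the regions at its sides, which must have the same colour; a crossing replaces the
  colour between its strands.  The list s contains the directions of the strands above the slice.\<close>

fun slice_op :: "complex \<Rightarrow> nat \<times> piece \<Rightarrow> bool list \<Rightarrow> (bool list \<Rightarrow> complex) \<Rightarrow> bool list \<Rightarrow> complex"
  where
  "slice_op z (p, LMax b) s \<phi> x = (\<Sum>c\<in>UNIV. \<phi> (take (Suc p) x @ [c] @ drop p x))"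
| "slice_op z (p, LMin) s \<phi> x =
     (if x ! p = x ! (p + 2) then \<phi> (take p x @ drop (p + 2) x) else 0)"
| "slice_op z (p, Cross c) s \<phi> x =
     (\<Sum>b\<in>UNIV. crossing_weight z c (s ! p) (s ! (p + 1)) (x ! p) (x ! (p + 1)) b (x ! (p + 2)) *
        \<phi> (x[p + 1 := b]))"

fun diagram_op ::
  "complex \<Rightarrow> diagram \<Rightarrow> bool list \<Rightarrow> (bool list \<Rightarrow> complex) \<Rightarrow> bool list \<Rightarrow> complex" where
  "diagram_op z [] s \<phi> = \<phi>"
| "diagram_op z (k # D) s \<phi> = slice_op z k s (diagram_op z D (the (slice_step k s)) \<phi>)"

lemma diagram_op_append:
  "run_slices D s = Some t \<Longrightarrow> diagram_op z (D @ E) s \<phi> = diagram_op z D s (diagram_op z E t \<phi>)"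
  by (induction D arbitrary: s) (auto split: bind_splits)

lemma slice_op_cong:
  assumes "slice_step k s = Some t" "length x = Suc (length s)"
    and "\<And>y. length y = Suc (length t) \<Longrightarrow> \<phi> y = \<psi> y"
  shows "slice_op z k s \<phi> x = slice_op z k s \<psi> x"
proof -
  obtain p q where k: "k = (p, q)" by fastforce
  show ?thesis
    using assms unfolding k by (cases q) (auto split: if_splits intro!: sum.cong)
qed

lemma diagram_op_cong:
  assumes "run_slices D s = Some t" "length x = Suc (length s)"
    and "\<And>y. length y = Suc (length t) \<Longrightarrow> \<phi> y = \<psi> y"
  shows "diagram_op z D s \<phi> x = diagram_op z D s \<psi> x"
  using assms(1,2)
proof (induction D arbitrary: s x)
  case (Cons k D)
  then obtain s' where "slice_step k s = Some s'" "run_slices D s' = Some t"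
    by (auto split: bind_splits)
  with Cons show ?case by (auto intro: slice_op_cong)
qed (simp add: assms(3))

lemma split_list_at:
  "p + k \<le> length xs \<Longrightarrow> \<exists>u w v. xs = u @ w @ v \<and> length u = p \<and> length w = k"
  by (rule exI [of _ "take p xs"], rule exI [of _ "take k (drop p xs)"],
      rule exI [of _ "drop k (drop p xs)"]) (simp del: drop_drop)

lemma split_list_2: "Suc p < length xs \<Longrightarrow> \<exists>u a b v. xs = u @ a # b # v \<and> length u = p"
  by (metis Cons_nth_drop_Suc Suc_lessD append_take_drop_id length_take min.absorb4)

lemma split_list_3:
  "Suc (Suc p) < length xs \<Longrightarrow> \<exists>u a b c v. xs = u @ a # b # c # v \<and> length u = p"
  by (metis Cons_nth_drop_Suc Suc_lessD append_take_drop_id length_take min.absorb4)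

lemma split_list_4:
  "Suc (Suc (Suc p)) < length xs \<Longrightarrow> \<exists>u a b c d v. xs = u @ a # b # c # d # v \<and> length u = p"
  by (metis Cons_nth_drop_Suc Suc_lessD append_take_drop_id length_take min.absorb4)

lemmas local_simps = UNIV_bool nth_append list_update_append Suc_diff_le

text \<open>A slice affects only the strands that it meets and the regions touching them.  This lemma and
  the next two cut out this part; the boundary region on the right (respectively left) is kept outside because
  it may at the same time touch another slice.\<close>

lemma slice_step_local:
  assumes "length s1 = p" "length sq = upper_ends q"
  shows "slice_step (p, q) (s1 @ sq @ s2) = map_option (\<lambda>t. s1 @ t @ s2) (slice_step (0, q) sq)"
  using assms by (cases q) (auto simp: local_simps length_Suc_conv numeral_2_eq_2)

lemma slice_op_local_left:
  assumes "length s1 = p" "length x1 = p" "length sq = upper_ends q" "length xq = upper_ends q"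
  shows "slice_op z (p, q) (s1 @ sq @ s2) \<phi> (x1 @ xq @ a # x2) =
    slice_op z (0, q) sq (\<lambda>ys. \<phi> (x1 @ butlast ys @ a # x2)) (xq @ [a])"
  using assms by (cases q) (auto simp: local_simps length_Suc_conv numeral_2_eq_2)

lemma slice_op_local_right:
  assumes "length s1 = p" "length x1 = p" "length sq = upper_ends q" "length xq = upper_ends q"
  shows "slice_op z (p, q) (s1 @ sq @ s2) \<phi> (x1 @ b # xq @ x2) =
    slice_op z (0, q) sq (\<lambda>ys. \<phi> (x1 @ b # tl ys @ x2)) (b # xq)"
  using assms by (cases q) (auto simp: local_simps length_Suc_conv numeral_2_eq_2)

lemma slice_op_commute:
  "slice_op z k s (\<lambda>ys. slice_op z k' s' (\<lambda>zs. F ys zs) x') x =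
   slice_op z k' s' (\<lambda>zs. slice_op z k s (\<lambda>ys. F ys zs) x) x'"
proof -
  obtain p q p' q' where k: "k = (p, q)" "k' = (p', q')" by fastforce
  show ?thesis unfolding k
    by (cases q; cases q') (simp_all add: UNIV_bool algebra_simps)
qed

text \<open>Each move is evaluated on the few strands and regions that it touches, after splitting the lists s
  and x around them.  The result is one of the weight identities, except for \<open>exchange\<close>, which is
  the commutation of two slices acting on different parts.\<close>

lemma diagram_move_op:
  assumes "z \<noteq> 0" "diagram_move l r" "run_slices l s = Some t" "run_slices r s = Some t'"
    and "length x = Suc (length s)"
  shows "t = t' \<and> diagram_op z l s \<phi> x = diagram_op z r s \<phi> x"
  using assms(2-5)
proof cases
  case (zigzag_left p b)
  then have "p < length s"
    using assms(3) by (auto split: if_splits)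
  then obtain s1 d s2 where s: "s = s1 @ d # s2" "length s1 = p"
    using split_list_1 by blast
  moreover obtain x1 a0 a1 x2 where x: "x = x1 @ a0 # a1 # x2" "length x1 = p"
    using split_list_2 [of p x] assms(5) \<open>p < length s\<close> by auto
  ultimately show ?thesis
    using assms zigzag_left by (auto simp: local_simps split: if_splits)
next
  case (zigzag_right p b)
  then have "p < length s"
    using assms(3) by (auto split: if_splits)
  then obtain s1 d s2 where s: "s = s1 @ d # s2" "length s1 = p"
    using split_list_1 by blast
  moreover obtain x1 a0 a1 x2 where x: "x = x1 @ a0 # a1 # x2" "length x1 = p"
    using split_list_2 [of p x] assms(5) \<open>p < length s\<close> by auto
  ultimately show ?thesis
    using assms zigzag_right by (auto simp: local_simps split: if_splits)
next
  case (slide_max p b c)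
  then have "p < length s"
    using assms(3) by (auto split: if_splits)
  then obtain s1 d s2 where s: "s = s1 @ d # s2" "length s1 = p"
    using split_list_1 by blast
  moreover obtain x1 a0 a1 x2 where x: "x = x1 @ a0 # a1 # x2" "length x1 = p"
    using split_list_2 [of p x] assms(5) \<open>p < length s\<close> by auto
  ultimately show ?thesis
    using assms slide_max
    by (auto simp: local_simps crossing_weight_rotate [of z c b d] split: if_splits)
next
  case (slide_min p c)
  then have "Suc (Suc p) < length s"
    using assms(3) by (auto split: if_splits)
  then obtain s1 d1 d2 d3 s2 where s: "s = s1 @ d1 # d2 # d3 # s2" "length s1 = p"
    using split_list_3 by blast
  moreover obtain x1 a0 a1 a2 a3 x2 where x: "x = x1 @ a0 # a1 # a2 # a3 # x2" "length x1 = p"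
    using split_list_4 [of p x] assms(5) \<open>Suc (Suc p) < length s\<close> by auto
  moreover have "d1 = (\<not> d3)"
    using assms(3) slide_min s by (auto simp: local_simps split: if_splits)
  ultimately show ?thesis
    using assms slide_min
    by (auto simp: local_simps crossing_weight_rotate [of z c d3 d2] split: if_splits)
next
  case (R1_max p b c)
  then have "p \<le> length s"
    using assms(3) by (auto split: if_splits)
  then obtain s1 s2 where s: "s = s1 @ s2" "length s1 = p"
    by (metis append_take_drop_id length_take min.absorb2)
  moreover obtain x1 a0 x2 where x: "x = x1 @ a0 # x2" "length x1 = p"
    using split_list_1 [of p x] assms(5) \<open>p \<le> length s\<close> by auto
  ultimately have "t = t'" and
    L: "diagram_op z l s \<phi> x = (\<Sum>b'\<in>UNIV. (\<Sum>m\<in>UNIV. crossing_weight z c b (\<not> b) a0 m b' a0) *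
      \<phi> (x1 @ a0 # b' # a0 # x2))" and
    R: "diagram_op z r s \<phi> x = (\<Sum>b'\<in>UNIV. \<phi> (x1 @ a0 # b' # a0 # x2))"
    using assms R1_max
    by (auto simp: local_simps ring_distribs split: if_splits)
  have "diagram_op z l s \<phi> x = diagram_op z r s \<phi> x"
    unfolding L R by (simp add: crossing_weight_R1(1) [OF assms(1)])
  with \<open>t = t'\<close> show ?thesis by simp
next
  case (R1_min p c)
  then have "Suc p < length s"
    using assms(3) by (auto split: if_splits)
  then obtain s1 d1 d2 s2 where s: "s = s1 @ d1 # d2 # s2" "length s1 = p"
    using split_list_2 by blast
  moreover obtain x1 a0 a1 a2 x2 where x: "x = x1 @ a0 # a1 # a2 # x2" "length x1 = p"
    using split_list_3 [of p x] assms(5) \<open>Suc p < length s\<close> by auto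
  moreover have "d2 = (\<not> d1)"
    using assms(3) R1_min s by (auto simp: local_simps split: if_splits)
  ultimately have "t = t'" and
    L: "diagram_op z l s \<phi> x = (\<Sum>m\<in>UNIV. crossing_weight z c d1 (\<not> d1) a0 a1 m a2) *
      (if a0 = a2 then \<phi> (x1 @ a0 # x2) else 0)" and
    R: "diagram_op z r s \<phi> x = (if a0 = a2 then \<phi> (x1 @ a0 # x2) else 0)"
    using assms R1_min
    by (auto simp: local_simps ring_distribs split: if_splits)
  have "diagram_op z l s \<phi> x = diagram_op z r s \<phi> x"
    unfolding L R by (simp add: crossing_weight_R1(2) [OF assms(1)])
  with \<open>t = t'\<close> show ?thesis by simp
next
  case (R2 p c)
  then have "Suc p < length s"
    using assms(3) by (auto split: if_splits)
  then obtain s1 d1 d2 s2 where s: "s = s1 @ d1 # d2 # s2" "length s1 = p"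
    using split_list_2 by blast
  moreover obtain x1 a0 a1 a2 x2 where x: "x = x1 @ a0 # a1 # a2 # x2" "length x1 = p"
    using split_list_3 [of p x] assms(5) \<open>Suc p < length s\<close> by auto
  ultimately have "t = s \<and> t' = s" and "diagram_op z l s \<phi> x = (\<Sum>b\<in>UNIV.
     (\<Sum>m\<in>UNIV. crossing_weight z c d1 d2 a0 a1 m a2 * crossing_weight z (\<not> c) d2 d1 a0 m b a2) * \<phi> (x1 @ a0 # b # a2 # x2))"
    using assms R2
    by (auto simp: local_simps ring_distribs split: if_splits)
  moreover have "\<phi> x = (\<Sum>b\<in>UNIV. of_bool (a1 = b) * \<phi> (x1 @ a0 # b # a2 # x2))"
    using x by (cases a1) (auto simp: UNIV_bool)
  ultimately show ?thesis
    using R2 by (simp add: crossing_weight_R2 [OF assms(1)])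
next
  case (R3 b a c p)
  then have "Suc (Suc p) < length s"
    using assms(3) by (auto split: if_splits)
  then obtain s1 d1 d2 d3 s2 where s: "s = s1 @ d1 # d2 # d3 # s2" "length s1 = p"
    using split_list_3 by blast
  moreover obtain x1 a0 a1 a2 a3 x2 where x: "x = x1 @ a0 # a1 # a2 # a3 # x2" "length x1 = p"
    using split_list_4 [of p x] assms(5) \<open>Suc (Suc p) < length s\<close> by auto
  ultimately have "t = t'" and
    L: "diagram_op z l s \<phi> x = (\<Sum>b1\<in>UNIV. \<Sum>b2\<in>UNIV.
      (\<Sum>m\<in>UNIV. crossing_weight z a d1 d2 a0 a1 m a2 * crossing_weight z b d1 d3 m a2 b2 a3
             * crossing_weight z c d2 d3 a0 m b1 b2) * \<phi> (x1 @ a0 # b1 # b2 # a3 # x2))" and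
    R: "diagram_op z r s \<phi> x = (\<Sum>b1\<in>UNIV. \<Sum>b2\<in>UNIV.
      (\<Sum>m\<in>UNIV. crossing_weight z c d2 d3 a1 a2 m a3 * crossing_weight z b d1 d3 a0 a1 b1 m
             * crossing_weight z a d1 d2 b1 m b2 a3) * \<phi> (x1 @ a0 # b1 # b2 # a3 # x2))"
    using assms R3
    by (auto simp: local_simps ring_distribs split: if_splits)
  have "diagram_op z l s \<phi> x = diagram_op z r s \<phi> x"
    unfolding L R
    by (intro sum.cong HOL.refl arg_cong2 [where f = "(*)"] crossing_weight_R3 assms(1)) (use R3 in auto)
  with \<open>t = t'\<close> show ?thesis by simp
next
  case (exchange p q e k)
  have room: "p + upper_ends q + (e + upper_ends k) \<le> length s"
    using assms(4) exchange by (cases k) (auto split: bind_splits if_splits)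
  obtain s1 sq s' where s1: "s = s1 @ sq @ s'" "length s1 = p" "length sq = upper_ends q"
    using room split_list_at [of p "upper_ends q" s] by auto
  moreover obtain s2 sk s3 where s2: "s' = s2 @ sk @ s3" "length s2 = e" "length sk = upper_ends k"
    using room split_list_at [of e "upper_ends k" s'] s1 by auto
  ultimately have s: "s = s1 @ sq @ s2 @ sk @ s3" by simp
  obtain x1 xq x' where x1: "x = x1 @ xq @ x'" "length x1 = p" "length xq = upper_ends q"
    using room split_list_at [of p "upper_ends q" x] assms(5) by auto
  moreover obtain xm xk x3 where x2: "x' = xm @ xk @ x3" "length xm = Suc e" "length xk = upper_ends k"
    using room split_list_at [of "Suc e" "upper_ends k" x'] assms(5) x1 by auto
  ultimately have x: "x = x1 @ xq @ xm @ xk @ x3" by simp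
  \<comment> \<open>The regions between the two slices form the nonempty list xm.  Its first region a touches the
    left slice and its last region b the right one; they coincide if no strand lies between.\<close>
  obtain a xa where a: "xm = a # xa" using x2 by (cases xm) auto
  obtain b xb where b: "xm = xb @ [b]" using x2 by (cases xm rule: rev_cases) auto
  have [simp]: "length xb = e" using b x2 by simp
  have ab: "a # xa @ w = xb @ b # w" for w
    using a b by (metis append_Cons append_Nil append_assoc)
  obtain tq where tq: "slice_step (0, q) sq = Some tq"
    using assms(3) s1 s exchange by (auto simp: slice_step_local split: bind_splits)
  obtain tk where tk: "slice_step (0, k) sk = Some tk"
    using assms(4) slice_step_local [of "s1 @ sq @ s2" "p + upper_ends q + e" sk k s3] s1 s2 s exchange
    by (auto split: bind_splits)
  have [simp]: "length tq = lower_ends q"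
    using tq s1 by (cases q) (auto split: if_splits)
  have q_step: "slice_step (p, q) (s1 @ sq @ u) = Some (s1 @ tq @ u)" for u
    using s1 tq by (simp add: slice_step_local)
  have k_step: "slice_step (p', k) (u @ sk @ s3) = Some (u @ tk @ s3)" if "length u = p'" for u p'
    using that s2 tk by (simp add: slice_step_local)
  have l_step: "slice_step (p + lower_ends q + e, k) (s1 @ tq @ s2 @ sk @ s3) = Some (s1 @ tq @ s2 @ tk @ s3)"
    using k_step [of "s1 @ tq @ s2"] s1 s2 by (simp add: add.assoc)
  have r_step: "slice_step (p + upper_ends q + e, k) (s1 @ sq @ s2 @ sk @ s3) = Some (s1 @ sq @ s2 @ tk @ s3)"
    using k_step [of "s1 @ sq @ s2"] s1 s2 by (simp add: add.assoc)
  have "t = t'"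
    using assms(3,4) exchange s q_step l_step r_step by simp
  have "diagram_op z l s \<phi> x = slice_op z (p, q) (s1 @ sq @ s2 @ sk @ s3)
      (slice_op z (p + lower_ends q + e, k) (s1 @ tq @ s2 @ sk @ s3) \<phi>) (x1 @ xq @ a # xa @ xk @ x3)"
    using exchange s x a q_step by simp
  also have "\<dots> = slice_op z (0, q) sq (\<lambda>ys. slice_op z (p + lower_ends q + e, k) (s1 @ tq @ s2 @ sk @ s3) \<phi>
      (x1 @ butlast ys @ a # xa @ xk @ x3)) (xq @ [a])"
    using s1 x1 by (intro slice_op_local_left) auto
  also have "\<dots> = slice_op z (0, q) sq (\<lambda>ys. slice_op z (0, k) sk (\<lambda>zs. \<phi>
      (x1 @ butlast ys @ a # xa @ tl zs @ x3)) (b # xk)) (xq @ [a])"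
  proof (rule slice_op_cong [OF tq])
    show "length (xq @ [a]) = Suc (length sq)" using s1 x1 by simp
    fix ys :: "bool list" assume "length ys = Suc (length tq)"
    then show "slice_op z (p + lower_ends q + e, k) (s1 @ tq @ s2 @ sk @ s3) \<phi> (x1 @ butlast ys @ a # xa @ xk @ x3) =
      slice_op z (0, k) sk (\<lambda>zs. \<phi> (x1 @ butlast ys @ a # xa @ tl zs @ x3)) (b # xk)"
      using slice_op_local_right [of "s1 @ tq @ s2" "p + lower_ends q + e" "x1 @ butlast ys @ xb" sk k xk z s3 \<phi> b x3]
        s1 s2 x1 x2(3) by (simp add: ab)
  qed
  also have "\<dots> = slice_op z (0, k) sk (\<lambda>zs. slice_op z (0, q) sq (\<lambda>ys. \<phi>
      (x1 @ butlast ys @ a # xa @ tl zs @ x3)) (xq @ [a])) (b # xk)"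
    by (rule slice_op_commute)
  also have "\<dots> = slice_op z (0, k) sk (\<lambda>zs. slice_op z (p, q) (s1 @ sq @ s2 @ tk @ s3) \<phi>
      (x1 @ xq @ a # xa @ tl zs @ x3)) (b # xk)"
    using slice_op_local_left [of s1 p x1 sq q xq z "s2 @ tk @ s3" \<phi> a] s1 x1 by simp
  also have "\<dots> = slice_op z (p + upper_ends q + e, k) (s1 @ sq @ s2 @ sk @ s3)
      (slice_op z (p, q) (s1 @ sq @ s2 @ tk @ s3) \<phi>) x"
    using slice_op_local_right [of "s1 @ sq @ s2" "p + upper_ends q + e" "x1 @ xq @ xb" sk k xk z s3
        "slice_op z (p, q) (s1 @ sq @ s2 @ tk @ s3) \<phi>" b x3] s1 s2 x1(2,3) x2(3) by (simp add: ab x a add.assoc)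
  also have "\<dots> = diagram_op z r s \<phi> x"
    using exchange s r_step by simp
  finally show ?thesis using \<open>t = t'\<close> by simp
qed

definition diagram_value :: "complex \<Rightarrow> diagram \<Rightarrow> complex" where
  "diagram_value z D = (\<Sum>a\<in>UNIV. diagram_op z D [] (\<lambda>_. 1) [a])"

lemma diagram_value_isotopic:
  assumes "z \<noteq> 0" "isotopic D E"
  shows "link_diagram D \<and> link_diagram E \<and> diagram_value z D = diagram_value z E"
  using assms(2)
proof induction
  case (move l r u v)
  obtain s where s: "run_slices u [] = Some s"
    using move by (auto simp: link_diagram_def run_slices_append split: bind_splits)
  obtain t where t: "run_slices l s = Some t"
    using move s by (auto simp: link_diagram_def run_slices_append split: bind_splits)
  obtain t' where t': "run_slices r s = Some t'"
    using move s by (auto simp: link_diagram_def run_slices_append split: bind_splits)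
  have "diagram_op z (u @ l @ v) [] \<phi> [a] = diagram_op z (u @ r @ v) [] \<phi> [a]" for \<phi> a
  proof -
    have "t = t'"
      using diagram_move_op [OF assms(1) move(1) t t', of "replicate (Suc (length s)) True"] by simp
    have "diagram_op z u [] (diagram_op z l s (diagram_op z v t \<phi>)) [a] =
        diagram_op z u [] (diagram_op z r s (diagram_op z v t \<phi>)) [a]"
      using diagram_move_op [OF assms(1) move(1) t t'] by (intro diagram_op_cong [OF s]) auto
    then show ?thesis
      using s t t' \<open>t = t'\<close> by (simp add: diagram_op_append)
  qed
  with move show ?case by (simp add: diagram_value_def)
qed auto

abbreviation colourings :: "nat \<Rightarrow> bool list set" where
  "colourings N \<equiv> {x. length x = N}"

lemma finite_colourings [simp]: "finite (colourings N)"
  using finite_lists_length_eq [of "UNIV :: bool set" N] by simp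

lemma sum_colourings_append:
  "(\<Sum>x\<in>colourings (M + N). f x) = (\<Sum>u\<in>colourings M. \<Sum>v\<in>colourings N. f (u @ v))"
  unfolding sum.cartesian_product
  by (rule sum.reindex_bij_witness [where i = "\<lambda>(u, v). u @ v" and j = "\<lambda>x. (take M x, drop M x)"]) auto

lemma colourings_0 [simp]: "colourings 0 = {[]}"
  by auto

lemma colourings_1: "colourings (Suc 0) = (\<lambda>a. [a]) ` UNIV"
  by (auto simp: length_Suc_conv)

lemma sum_colourings_1: "(\<Sum>x\<in>colourings (Suc 0). f x) = (\<Sum>a\<in>UNIV. f [a])"
  unfolding colourings_1 by (subst sum.reindex) (auto simp: inj_on_def)

lemma sum_colourings_Cons: "(\<Sum>x\<in>colourings (Suc N). f x) = (\<Sum>a\<in>UNIV. \<Sum>x\<in>colourings N. f (a # x))"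
  using sum_colourings_append [of f "Suc 0" N] by (simp add: sum_colourings_1)

lemma sum_colourings_snoc: "(\<Sum>x\<in>colourings (Suc N). f x) = (\<Sum>x\<in>colourings N. \<Sum>a\<in>UNIV. f (x @ [a]))"
  using sum_colourings_append [of f N "Suc 0"] by (simp add: sum_colourings_1)

section \<open>State sums of braid closures\<close>

text \<open>After the maxima the colours read \<open>a, y\<^sub>1, \<dots>, y\<^sub>n, \<dots>, y\<^sub>1, a\<close>: the region inside the n-th
  arc occurs once, all others occur on both sides.\<close>

lemma op_closing_maxima:
  "diagram_op z (closing_maxima n) [] \<phi> [a] = (\<Sum>ys\<in>colourings n. \<phi> ((a # ys) @ tl (rev (a # ys))))"
proof (induction n arbitrary: \<phi>)
  case (Suc n)
  have *: "slice_op z (n, LMax True) s \<phi> ((a # ys) @ tl (rev (a # ys))) =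
      (\<Sum>c\<in>UNIV. \<phi> ((a # (ys @ [c])) @ tl (rev (a # (ys @ [c])))))" if "length ys = n" for ys s
  proof -
    have "drop n ((a # ys) @ tl (rev (a # ys))) = rev (a # ys)"
      using that by (cases ys rule: rev_cases) auto
    then show ?thesis using that by simp
  qed
  show ?case
    by (simp add: closing_maxima_Suc diagram_op_append [OF run_closing_maxima] Suc sum_colourings_snoc
        * del: slice_op.simps append_Cons rev.simps)
qed simp

text \<open>The minima compare the colours on the left with those on the right.  The innermost region has no
  partner, hence \<open>butlast\<close>.\<close>

lemma op_closing_minima:
  assumes "length x = Suc n" "length y = Suc n"
  shows "diagram_op z (closing_minima n) s (\<lambda>_. 1) (y @ tl (rev x)) = of_bool (butlast y = butlast x)"
  using assms
proof (induction n arbitrary: s x y)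
  case 0
  then show ?case by (cases x; cases y) auto
next
  case (Suc n)
  obtain x0 b c where x: "x = x0 @ [b, c]"
    using Suc.prems(1) by (cases x rule: rev_cases; cases "butlast x" rule: rev_cases) auto
  obtain y0 d e where y: "y = y0 @ [d, e]"
    using Suc.prems(2) by (cases y rule: rev_cases; cases "butlast y" rule: rev_cases) auto
  have len: "length x0 = n" "length y0 = n"
    using Suc.prems x y by simp_all
  have "diagram_op z (closing_minima (Suc n)) s (\<lambda>_. 1) (y @ tl (rev x)) =
      (if d = b then diagram_op z (closing_minima n) (the (slice_step (n, LMin) s)) (\<lambda>_. 1)
        ((y0 @ [b]) @ tl (rev (x0 @ [b]))) else 0)"
    using len by (simp add: x y closing_minima_Suc nth_append)
  also have "\<dots> = of_bool (butlast y = butlast x)"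
    using len by (subst Suc.IH) (auto simp: x y butlast_append)
  finally show ?case .
qed

abbreviation word_op :: "complex \<Rightarrow> nat \<Rightarrow> braid_word \<Rightarrow> (bool list \<Rightarrow> complex) \<Rightarrow> bool list \<Rightarrow> complex" where
  "word_op z n w \<equiv> diagram_op z (crossings w) (replicate n True)"

lemma op_crossings_Cons:
  assumes "Suc 0 \<le> i" "i < n" "length x = Suc n"
  shows "diagram_op z (crossings ((i, c) # w)) (replicate n True @ s) \<phi> (x @ v) =
    (\<Sum>b\<in>UNIV. crossing_weight z c True True (x ! (i - Suc 0)) (x ! i) b (x ! Suc i) *
       diagram_op z (crossings w) (replicate n True @ s) \<phi> (x[i := b] @ v))"
  using assms step_parallel_crossing [of i n c s]
  by (simp add: nth_append list_update_append del: slice_step.simps)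

lemma word_op_Cons:
  assumes "Suc 0 \<le> i" "i < n" "length x = Suc n"
  shows "word_op z n ((i, c) # w) \<phi> x =
    (\<Sum>b\<in>UNIV. crossing_weight z c True True (x ! (i - Suc 0)) (x ! i) b (x ! Suc i) *
       word_op z n w \<phi> (x[i := b]))"
  using op_crossings_Cons [OF assms, of z c w "[]" \<phi> "[]"] by simp

lemma op_crossings_local:
  assumes "w \<in> braid_words n" "length x = Suc n"
  shows "diagram_op z (crossings w) (replicate n True @ s) \<phi> (x @ v) = word_op z n w (\<lambda>y. \<phi> (y @ v)) x"
  using assms
proof (induction w arbitrary: x)
  case (Cons k w)
  obtain i c where k: "k = (i, c)" by fastforce
  have *: "Suc 0 \<le> i" "i < n" "w \<in> braid_words n"
    using Cons.prems by (auto simp: k braid_words_Cons)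
  have IH: "diagram_op z (crossings w) (replicate n True @ s) \<phi> (x[i := b] @ v) =
      word_op z n w (\<lambda>y. \<phi> (y @ v)) (x[i := b])" for b
    using Cons.IH [of "x[i := b]"] Cons.prems * by simp
  show ?case
    unfolding k op_crossings_Cons [OF *(1,2) Cons.prems(2)] word_op_Cons [OF *(1,2) Cons.prems(2)] IH ..
qed simp

text \<open>Braids never change the last colour: a crossing changes the colour between its strands only.\<close>

lemma word_op_cong:
  assumes "w \<in> braid_words n" "length x = Suc n"
    and "\<And>y. length y = Suc n \<Longrightarrow> last y = last x \<Longrightarrow> \<phi> y = \<psi> y"
  shows "word_op z n w \<phi> x = word_op z n w \<psi> x"
  using assms
proof (induction w arbitrary: x)
  case (Cons k w)
  obtain i c where k: "k = (i, c)" by fastforce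
  have *: "Suc 0 \<le> i" "i < n" "w \<in> braid_words n"
    using Cons.prems by (auto simp: k braid_words_Cons)
  have "last (x[i := b]) = last x" for b
    using * Cons.prems(2) by (subst last_list_update) auto
  then have IH: "word_op z n w \<phi> (x[i := b]) = word_op z n w \<psi> (x[i := b])" for b
    using Cons.prems * by (intro Cons.IH) auto
  show ?case
    unfolding k word_op_Cons [OF *(1,2) Cons.prems(2)] IH ..
qed simp

text \<open>The state sum is a trace.  The minima force all colours but the last to return to their initial
  values, and the last one returns because braids do not change it.\<close>

lemma diagram_value_closure:
  assumes "w \<in> braid_words n"
  shows "diagram_value z (closure_diagram n w) =
    (\<Sum>x\<in>colourings (Suc n). word_op z n w (\<lambda>y. of_bool (y = x)) x)"
proof -
  have "diagram_op z (crossings w @ closing_minima n) (closure_strands n) (\<lambda>_. 1) (x @ tl (rev x)) =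
      word_op z n w (\<lambda>y. of_bool (y = x)) x" if "length x = Suc n" for x
  proof -
    have "diagram_op z (crossings w @ closing_minima n) (closure_strands n) (\<lambda>_. 1) (x @ tl (rev x)) =
        word_op z n w (\<lambda>y. diagram_op z (closing_minima n) (closure_strands n) (\<lambda>_. 1) (y @ tl (rev x))) x"
      using diagram_op_append [OF run_crossings [OF assms]] op_crossings_local [OF assms that] by simp
    also have "\<dots> = word_op z n w (\<lambda>y. of_bool (y = x)) x"
    proof (rule word_op_cong [OF assms that])
      fix y :: "bool list" assume y: "length y = Suc n" "last y = last x"
      have "butlast y = butlast x \<longleftrightarrow> y = x"
      proof
        assume *: "butlast y = butlast x"
        have "y \<noteq> []" "x \<noteq> []" using y that by auto
        from \<open>y \<noteq> []\<close> have "butlast y @ [last y] = y"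
          by (rule append_butlast_last_id)
        moreover from \<open>x \<noteq> []\<close> have "butlast x @ [last x] = x"
          by (rule append_butlast_last_id)
        ultimately show "y = x" unfolding * y(2) by (rule HOL.trans [OF HOL.sym])
      qed simp
      then show "diagram_op z (closing_minima n) (closure_strands n) (\<lambda>_. 1) (y @ tl (rev x)) = of_bool (y = x)"
        using op_closing_minima [OF that y(1)] by simp
    qed
    finally show ?thesis .
  qed
  note * = this
  have "diagram_op z (closure_diagram n w) [] (\<lambda>_. 1) [a] =
      (\<Sum>ys\<in>colourings n. word_op z n w (\<lambda>y. of_bool (y = a # ys)) (a # ys))" for a
    unfolding closure_diagram_eq diagram_op_append [OF run_closing_maxima] op_closing_maxima
    by (intro sum.cong HOL.refl *) simp_all
  then show ?thesis
    by (simp add: diagram_value_def sum_colourings_Cons)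
qed

lemma diagram_value_trivial: "diagram_value z (concat (replicate n (circle 0))) = 2 ^ (n + 1)"
proof -
  have "diagram_op z (concat (replicate n (circle 0))) [] (\<lambda>_. 1) [a] = 2 ^ n" for a
    by (induction n) (simp_all add: UNIV_bool)
  then show ?thesis by (simp add: diagram_value_def UNIV_bool)
qed

lemma diagram_value_skein:
  assumes "z \<noteq> 0" "w \<in> braid_words n" "2 \<le> n"
  shows "diagram_value z (closure_diagram n ((1, True) # w)) + diagram_value z (closure_diagram n ((1, False) # w))
    = diagram_value z (closure_diagram n w)"
proof -
  have "word_op z n ((1, True) # w) \<phi> x + word_op z n ((1, False) # w) \<phi> x = word_op z n w \<phi> x"
    if "length x = Suc n" for \<phi> x
  proof -
    have "word_op z n ((1, True) # w) \<phi> x + word_op z n ((1, False) # w) \<phi> x =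
      (\<Sum>b\<in>UNIV. (crossing_weight z True True True (x ! 0) (x ! 1) b (x ! 2) +
        crossing_weight z False True True (x ! 0) (x ! 1) b (x ! 2)) * word_op z n w \<phi> (x[1 := b]))"
      using that assms(3) by (simp add: word_op_Cons sum.distrib distrib_right numeral_2_eq_2 del: crossings_simps)
    also have "\<dots> = (\<Sum>b\<in>UNIV. of_bool (x ! 1 = b) * word_op z n w \<phi> (x[1 := b]))"
      by (simp only: crossing_weight_skein [OF assms(1)])
    also have "\<dots> = word_op z n w \<phi> (x[1 := x ! 1])"
      by (cases "x ! 1") (simp_all add: UNIV_bool)
    also have "\<dots> = word_op z n w \<phi> x"
      by simp
    finally show ?thesis .
  qed
  moreover have "(1, b) # w \<in> braid_words n" for b
    using assms by (simp add: braid_words_Cons)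
  ultimately show ?thesis
    using assms(2) by (simp add: diagram_value_closure sum.distrib [symmetric] del: crossings_simps)
qed

section \<open>Matrices acting on functions of colourings\<close>

text \<open>The position of the basis vector that belongs to a colouring in the lexicographic order.\<close>

fun code :: "bool list \<Rightarrow> nat" where
  "code [] = 0"
| "code (b # x) = of_bool b * 2 ^ length x + code x"

lemma code_less: "code x < 2 ^ length x"
  by (induction x) auto

lemma code_less_power: "length x = N \<Longrightarrow> code x < 2 ^ N"
  using code_less by blast

lemma code_append: "code (u @ v) = code u * 2 ^ length v + code v"
  by (induction u) (auto simp: power_add algebra_simps)

lemma code_inject: "length x = length y \<Longrightarrow> code x = code y \<Longrightarrow> x = y"
proof (induction x y rule: list_induct2)
  case (Cons a x b y)
  then show ?case
    using code_less [of x] code_less [of y] by (cases a; cases b) auto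
qed simp

lemma bij_betw_code: "bij_betw code (colourings N) {..<2 ^ N}"
  unfolding bij_betw_def
proof
  show inj: "inj_on code (colourings N)"
    by (auto intro!: inj_onI code_inject)
  show "code ` colourings N = {..<2 ^ N}"
  proof (rule card_subset_eq)
    show "code ` colourings N \<subseteq> {..<2 ^ N}" using code_less by auto
    show "card (code ` colourings N) = card {..<2 ^ N :: nat}"
      using card_lists_length_eq [of "UNIV :: bool set" N] by (simp add: card_image [OF inj])
  qed simp
qed

lemma sum_code: "(\<Sum>i<2 ^ N. f i) = (\<Sum>x\<in>colourings N. f (code x))"
  using sum.reindex_bij_betw [OF bij_betw_code, of f N] by simp

abbreviation square :: "nat \<Rightarrow> complex mat set" where
  "square N \<equiv> carrier_mat (2 ^ N) (2 ^ N)"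

text \<open>The rows of a matrix are the colours above and the columns those below: a product of matrices, read
  from left to right, acts like slices read from top to bottom.\<close>

definition act :: "nat \<Rightarrow> complex mat \<Rightarrow> (bool list \<Rightarrow> complex) \<Rightarrow> bool list \<Rightarrow> complex" where
  "act N A \<phi> x = (\<Sum>y\<in>colourings N. A $$ (code x, code y) * \<phi> y)"

lemma act_indicator: "length y = N \<Longrightarrow> act N A (\<lambda>x'. of_bool (x' = y)) x = A $$ (code x, code y)"
proof -
  assume "length y = N"
  have "act N A (\<lambda>x'. of_bool (x' = y)) x = (\<Sum>x'\<in>colourings N. if y = x' then A $$ (code x, code x') else 0)"
    unfolding act_def by (intro sum.cong) auto
  with \<open>length y = N\<close> show ?thesis by simp
qed

lemma mat_eq_if_act_eq:
  assumes "A \<in> square N" "B \<in> square N"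
    and "\<And>\<phi> x. length x = N \<Longrightarrow> act N A \<phi> x = act N B \<phi> x"
  shows "A = B"
proof (rule eq_matI)
  fix i j assume "i < dim_row B" "j < dim_col B"
  then have "i \<in> code ` colourings N" "j \<in> code ` colourings N"
    using assms(2) bij_betw_code [of N] by (auto simp: bij_betw_def)
  then show "A $$ (i, j) = B $$ (i, j)"
    using assms(3) by (auto simp flip: act_indicator)
qed (use assms in auto)

lemma mat_mult_code:
  assumes "A \<in> square N" "B \<in> square N" "length x = N" "length y = N"
  shows "(A * B) $$ (code x, code y) = (\<Sum>u\<in>colourings N. A $$ (code x, code u) * B $$ (code u, code y))"
  using assms code_less [of x] code_less [of y]
  by (simp add: scalar_prod_def sum_code flip: lessThan_atLeast0)

lemma act_mult:
  assumes "A \<in> square N" "B \<in> square N" "length x = N"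
  shows "act N (A * B) \<phi> x = act N A (act N B \<phi>) x"
proof -
  have "act N (A * B) \<phi> x = (\<Sum>y\<in>colourings N. \<Sum>u\<in>colourings N. A $$ (code x, code u) * B $$ (code u, code y) * \<phi> y)"
    using assms by (auto simp: act_def mat_mult_code sum_distrib_right intro!: sum.cong)
  also have "\<dots> = act N A (act N B \<phi>) x"
    unfolding act_def sum_distrib_left by (subst sum.swap) (simp add: mult.assoc)
  finally show ?thesis .
qed

lemma act_one: "length x = N \<Longrightarrow> act N (1\<^sub>m (2 ^ N)) \<phi> x = \<phi> x"
proof -
  assume x: "length x = N"
  have "act N (1\<^sub>m (2 ^ N)) \<phi> x = (\<Sum>y\<in>colourings N. if x = y then \<phi> y else 0)"
    unfolding act_def
  proof (intro sum.cong HOL.refl)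
    fix y assume "y \<in> colourings N"
    then show "1\<^sub>m (2 ^ N) $$ (code x, code y) * \<phi> y = (if x = y then \<phi> y else 0)"
      using x code_less [of x] code_less [of y] code_inject [of x y] by auto
  qed
  with x show ?thesis by simp
qed

lemma act_smult: "A \<in> square N \<Longrightarrow> length x = N \<Longrightarrow> act N (c \<cdot>\<^sub>m A) \<phi> x = c * act N A \<phi> x"
  unfolding act_def sum_distrib_left
  by (intro sum.cong HOL.refl) (auto simp: code_less_power)

lemma act_diff:
  assumes "A \<in> square N" "B \<in> square N" "length x = N"
  shows "act N (A - B) \<phi> x = act N A \<phi> x - act N B \<phi> x"
  unfolding act_def sum_subtractf [symmetric]
  using assms by (intro sum.cong HOL.refl) (auto simp: code_less_power left_diff_distrib)

lemma kron_square: "A \<in> square M \<Longrightarrow> B \<in> square N \<Longrightarrow> A \<otimes>\<^sub>k B \<in> square (M + N)"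
  by (simp add: kron_def power_add)

lemma kron_code:
  assumes "A \<in> square M" "B \<in> square N" "length u = M" "length u' = M" "length v = N" "length v' = N"
  shows "(A \<otimes>\<^sub>k B) $$ (code (u @ v), code (u' @ v')) = A $$ (code u, code u') * B $$ (code v, code v')"
proof -
  have lt: "code u * 2 ^ N + code v < 2 ^ M * 2 ^ N" "code u' * 2 ^ N + code v' < 2 ^ M * 2 ^ N"
    using code_less [of "u @ v"] code_less [of "u' @ v'"] assms(3-6)
    by (simp_all add: power_add code_append)
  have "code v < 2 ^ N" "code v' < 2 ^ N"
    using assms(5,6) by (simp_all add: code_less_power)
  then show ?thesis
    using assms(1,2) lt unfolding kron_def by (simp add: code_append assms(5,6))
qed

lemma act_kron:
  assumes "A \<in> square M" "B \<in> square N" "length u = M" "length v = N"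
  shows "act (M + N) (A \<otimes>\<^sub>k B) \<phi> (u @ v) = act M A (\<lambda>u'. act N B (\<lambda>v'. \<phi> (u' @ v')) v) u"
  unfolding act_def sum_colourings_append sum_distrib_left
  using assms by (intro sum.cong HOL.refl) (simp add: kron_code mult.assoc)

lemma kron_one: "1\<^sub>m a \<otimes>\<^sub>k 1\<^sub>m b = 1\<^sub>m (a * b)"
proof (rule eq_matI)
  fix i j assume "i < dim_row (1\<^sub>m (a * b) :: complex mat)" "j < dim_col (1\<^sub>m (a * b) :: complex mat)"
  then have ij: "i < a * b" "j < a * b" by simp_all
  then have "b > 0" "i div b < a" "j div b < a"
    by (auto simp: less_mult_imp_div_less intro: gr0I)
  moreover have "i div b = j div b \<and> i mod b = j mod b \<longleftrightarrow> i = j"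
    by (metis div_mult_mod_eq)
  ultimately show "(1\<^sub>m a \<otimes>\<^sub>k 1\<^sub>m b) $$ (i, j) = (1\<^sub>m (a * b) :: complex mat) $$ (i, j)"
    using ij by (auto simp: kron_def)
qed (simp_all add: kron_def)

lemma tensor_pow_one: "tensor_pow (1\<^sub>m d) r = 1\<^sub>m (d ^ r)"
  by (induction r) (simp_all add: kron_one)

lemma act_inner:
  assumes "A \<in> square 3" "length u = p" "length w = 3" "length v = q"
  shows "act (p + 3 + q) (1\<^sub>m (2 ^ p) \<otimes>\<^sub>k A \<otimes>\<^sub>k 1\<^sub>m (2 ^ q)) \<phi> (u @ w @ v) = act 3 A (\<lambda>w'. \<phi> (u @ w' @ v)) w"
proof -
  have "act (p + 3 + q) (1\<^sub>m (2 ^ p) \<otimes>\<^sub>k A \<otimes>\<^sub>k 1\<^sub>m (2 ^ q)) \<phi> ((u @ w) @ v) =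
      act (p + 3) (1\<^sub>m (2 ^ p) \<otimes>\<^sub>k A) (\<lambda>y. act q (1\<^sub>m (2 ^ q)) (\<lambda>v'. \<phi> (y @ v')) v) (u @ w)"
    using assms by (intro act_kron kron_square) auto
  also have "\<dots> = act (p + 3) (1\<^sub>m (2 ^ p) \<otimes>\<^sub>k A) (\<lambda>y. \<phi> (y @ v)) (u @ w)"
    using assms by (simp add: act_one)
  also have "\<dots> = act p (1\<^sub>m (2 ^ p)) (\<lambda>u'. act 3 A (\<lambda>w'. \<phi> ((u' @ w') @ v)) w) u"
    using assms by (intro act_kron) auto
  also have "\<dots> = act 3 A (\<lambda>w'. \<phi> (u @ w' @ v)) w"
    using assms by (simp add: act_one)
  finally show ?thesis by simp
qed

section \<open>The operator of type I\<close>

lemma mat_inv_eq: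
  assumes "A \<in> carrier_mat n n" "B \<in> carrier_mat n n" "A * B = 1\<^sub>m n" "B * A = 1\<^sub>m n"
  shows "mat_inv A = B"
proof (cases "mat_inverse A")
  case None
  moreover have "A \<in> Units (ring_mat TYPE(complex) n ())"
    using assms by (auto simp: Units_def ring_mat_def)
  ultimately show ?thesis using mat_inverse(1) [OF assms(1), where b = "()"] by blast
next
  case (Some C)
  then have C: "A * C = 1\<^sub>m n" "C * A = 1\<^sub>m n" "C \<in> carrier_mat n n"
    using mat_inverse(2) [OF assms(1)] by auto
  have "C = (B * A) * C" using C assms by simp
  also have "\<dots> = B * (A * C)" by (rule assoc_mult_mat) (use assms C in auto)
  also have "\<dots> = B" using C assms by simp
  finally show ?thesis by (simp add: mat_inv_def Some)
qed

abbreviation alpha :: complex where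
  "alpha \<equiv> exp (\<i> * pi / 4)"

text \<open>This is why \<open>\<alpha>\<close> times a crossing weight is \<open>1 / sqrt 2\<close> times a power of \<open>\<i>\<close> and of z, like the
  entries of R.\<close>

lemma alpha_half: "alpha * ((1 - \<i>) / 2) = complex_of_real (1 / sqrt 2)"
proof -
  have "\<i> * pi / 4 = \<i> * complex_of_real (pi / 4)" by simp
  then have "alpha = cis (pi / 4)" by (simp only: cis_conv_exp)
  also have "\<dots> = complex_of_real (1 / sqrt 2) * (1 + \<i>)"
    by (simp add: complex_eq_iff cos_45 sin_45 real_div_sqrt field_simps)
  finally have "alpha * ((1 - \<i>) / 2) = complex_of_real (1 / sqrt 2) * ((1 + \<i>) * (1 - \<i>) / 2)"
    by simp
  also have "(1 + \<i>) * (1 - \<i>) / 2 = 1" by (simp add: field_simps)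
  finally show ?thesis by simp
qed

text \<open>The first index selects one of the two blocks; inside a block only the entries with equal last
  indices are nonzero, and there are four of them for each last index.\<close>

lemma R_typeI_entry:
  fixes \<theta> :: real
  defines "z \<equiv> exp (\<i> * \<theta>)"
  shows "R_typeI \<theta> $$ (code [a, b, c], code [a', b', c']) =
    (if a = a' \<and> c = c' then alpha * crossing_weight z True True True a b b' c else 0)"
proof -
  have exps: "exp (\<i> * \<theta>) = z" "exp (- \<i> * \<theta>) = 1 / z" "exp (2 * \<i> * \<theta>) = z * z"
    "exp (- 2 * \<i> * \<theta>) = 1 / (z * z)"
  proof -
    have double: "2 * \<i> * \<theta> = \<i> * \<theta> + \<i> * \<theta>" and minus: "- \<i> * \<theta> = - (\<i> * \<theta>)"
      and minus_double: "- 2 * \<i> * \<theta> = - (\<i> * \<theta> + \<i> * \<theta>)"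
      by simp_all
    show "exp (\<i> * \<theta>) = z" "exp (- \<i> * \<theta>) = 1 / z" "exp (2 * \<i> * \<theta>) = z * z"
        "exp (- 2 * \<i> * \<theta>) = 1 / (z * z)"
      unfolding double minus minus_double exp_minus exp_add z_def by (simp_all add: inverse_eq_divide)
  qed
  have "z \<noteq> 0" by (simp add: z_def)
  define h where "h = complex_of_real (1 / sqrt 2)"
  have weight: "alpha * crossing_weight z True True True a b b' c = h * (crossing_phase True True True a b b' c *
     (edge z True a b' * edge z True b' c / (edge z True a b * edge z True b c)))"
    unfolding crossing_weight_def h_def alpha_half [symmetric] by simp
  have "\<forall>a b c a' b' c'. R_typeI \<theta> $$ (code [a, b, c], code [a', b', c']) =
    (if a = a' \<and> c = c' then h * (crossing_phase True True True a b b' c *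
     (edge z True a b' * edge z True b' c / (edge z True a b * edge z True b c))) else 0)"
    unfolding R_typeI_def exps h_def [symmetric] all_bool_eq
    using \<open>z \<noteq> 0\<close> by (simp add: mat_of_rows_list_def crossing_phase_simps turn_simps edge_def Let_def)
  then show ?thesis unfolding weight by blast
qed

lemma R_typeI_square: "R_typeI \<theta> \<in> square 3"
  by (rule carrier_matI) (simp_all add: R_typeI_def mat_of_rows_list_def Let_def)

lemma length_3E:
  assumes "length x = 3" obtains a b c where "x = [a, b, c]"
  using assms by (auto simp: length_Suc_conv numeral_3_eq_3)

lemma sum_colourings_3:
  "(\<Sum>x\<in>colourings 3. f x) = (\<Sum>a\<in>UNIV. \<Sum>b\<in>UNIV. \<Sum>c\<in>UNIV. f [a, b, c])"
  by (simp add: numeral_3_eq_3 sum_colourings_Cons)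

lemma act_R_typeI:
  "act 3 (R_typeI \<theta>) \<phi> [a, b, c] =
    alpha * (\<Sum>d\<in>UNIV. crossing_weight (exp (\<i> * \<theta>)) True True True a b d c * \<phi> [a, d, c])"
  unfolding act_def sum_colourings_3 R_typeI_entry
  by (cases a; cases c; simp add: UNIV_bool algebra_simps)

text \<open>The quadratic equation \<open>\<alpha>\<^sup>-\<^sup>1 R + \<alpha> R\<^sup>-\<^sup>1 = 1\<close>, solved for the inverse.\<close>

definition R_inv :: "real \<Rightarrow> complex mat" where
  "R_inv \<theta> = inverse alpha \<cdot>\<^sub>m (1\<^sub>m (2 ^ 3) - inverse alpha \<cdot>\<^sub>m R_typeI \<theta>)"

lemma R_inv_square: "R_inv \<theta> \<in> square 3"
  unfolding R_inv_def
  by (intro smult_carrier_mat minus_carrier_mat R_typeI_square)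

lemma act_R_inv:
  "act 3 (R_inv \<theta>) \<phi> [a, b, c] =
    inverse alpha * (\<Sum>d\<in>UNIV. crossing_weight (exp (\<i> * \<theta>)) False True True a b d c * \<phi> [a, d, c])"
proof -
  let ?z = "exp (\<i> * complex_of_real \<theta>)"
  have "act 3 (R_inv \<theta>) \<phi> [a, b, c] = inverse alpha * (\<phi> [a, b, c] - inverse alpha * act 3 (R_typeI \<theta>) \<phi> [a, b, c])"
  proof -
    have len: "length [a, b, c] = 3" by simp
    have scaled: "inverse alpha \<cdot>\<^sub>m R_typeI \<theta> \<in> square 3"
      by (intro smult_carrier_mat R_typeI_square)
    show ?thesis
      unfolding R_inv_def act_smult [OF minus_carrier_mat [OF scaled] len]
        act_diff [OF one_carrier_mat scaled len] act_smult [OF R_typeI_square len] act_one [OF len] ..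
  qed
  also have "\<phi> [a, b, c] = (\<Sum>d\<in>UNIV. of_bool (b = d) * \<phi> [a, d, c])"
    by (cases b) (simp_all add: UNIV_bool)
  also have "\<dots> - inverse alpha * act 3 (R_typeI \<theta>) \<phi> [a, b, c] =
      (\<Sum>d\<in>UNIV. crossing_weight ?z False True True a b d c * \<phi> [a, d, c])"
  proof -
    have cancel: "inverse alpha * (alpha * y) = y" for y by simp
    have "of_bool (b = d) - crossing_weight ?z True True True a b d c = crossing_weight ?z False True True a b d c" for d
      using crossing_weight_skein [of ?z a b d c] by (simp add: algebra_simps)
    then show ?thesis
      unfolding act_R_typeI cancel by (simp only: flip: sum_subtractf left_diff_distrib)
  qed
  finally show ?thesis .
qed

text \<open>The second Reidemeister move for two downward strands.\<close>

lemma crossing_weight_inverse: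
  assumes "z \<noteq> 0"
  shows "(\<Sum>d\<in>UNIV. crossing_weight z s True True a b d c * (\<Sum>e\<in>UNIV. crossing_weight z (\<not> s) True True a d e c * \<phi> [a, e, c]))
    = \<phi> [a, b, c]"
proof -
  have "(\<Sum>d\<in>UNIV. crossing_weight z s True True a b d c * (\<Sum>e\<in>UNIV. crossing_weight z (\<not> s) True True a d e c * \<phi> [a, e, c])) =
    (\<Sum>e\<in>UNIV. (\<Sum>d\<in>UNIV. crossing_weight z s True True a b d c * crossing_weight z (\<not> s) True True a d e c) * \<phi> [a, e, c])"
    by (simp add: UNIV_bool algebra_simps)
  also have "\<dots> = \<phi> [a, b, c]"
    unfolding crossing_weight_R2 [OF assms] by (cases b) (simp_all add: UNIV_bool)
  finally show ?thesis .
qed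

lemma R_typeI_inverse:
  "R_typeI \<theta> * R_inv \<theta> = 1\<^sub>m (2 ^ 3)" "R_inv \<theta> * R_typeI \<theta> = 1\<^sub>m (2 ^ 3)"
proof -
  let ?z = "exp (\<i> * complex_of_real \<theta>)"
  note sq = R_typeI_square [of \<theta>] R_inv_square [of \<theta>]
  show "R_typeI \<theta> * R_inv \<theta> = 1\<^sub>m (2 ^ 3)"
  proof (rule mat_eq_if_act_eq)
    fix \<phi> and x :: "bool list" assume x: "length x = 3"
    then obtain a b c where abc: "x = [a, b, c]" by (rule length_3E)
    have len: "length [a, b, c] = 3" by simp
    show "act 3 (R_typeI \<theta> * R_inv \<theta>) \<phi> x = act 3 (1\<^sub>m (2 ^ 3)) \<phi> x"
      using crossing_weight_inverse [of ?z True a b c \<phi>]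
      unfolding abc act_mult [OF sq(1,2) len] act_one [OF len] act_R_typeI act_R_inv
      by (simp add: mult.left_commute [of _ "inverse alpha"] flip: sum_distrib_left)
  qed (use sq in auto)
  show "R_inv \<theta> * R_typeI \<theta> = 1\<^sub>m (2 ^ 3)"
  proof (rule mat_eq_if_act_eq)
    fix \<phi> and x :: "bool list" assume x: "length x = 3"
    then obtain a b c where abc: "x = [a, b, c]" by (rule length_3E)
    have len: "length [a, b, c] = 3" by simp
    show "act 3 (R_inv \<theta> * R_typeI \<theta>) \<phi> x = act 3 (1\<^sub>m (2 ^ 3)) \<phi> x"
      using crossing_weight_inverse [of ?z False a b c \<phi>]
      unfolding abc act_mult [OF sq(2,1) len] act_one [OF len] act_R_typeI act_R_inv
      by (simp add: mult.left_commute [of _ alpha] flip: sum_distrib_left)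
  qed (use sq in auto)
qed

lemma mat_inv_R_typeI: "mat_inv (R_typeI \<theta>) = R_inv \<theta>"
  by (rule mat_inv_eq [OF R_typeI_square R_inv_square R_typeI_inverse])

section \<open>Matrices of braid words\<close>

definition word_exponent :: "braid_word \<Rightarrow> int" where
  "word_exponent w = (\<Sum>(i, b)\<leftarrow>w. if b then 1 else - 1)"

definition word_mat :: "real \<Rightarrow> nat \<Rightarrow> braid_word \<Rightarrow> complex mat" where
  "word_mat \<theta> n w = foldr (\<lambda>k M. letter_rep 2 1 (R_typeI \<theta>) n k * M) w (1\<^sub>m (2 ^ Suc n))"

lemma word_mat_simps [simp]:
  "word_mat \<theta> n [] = 1\<^sub>m (2 ^ Suc n)"
  "word_mat \<theta> n (k # w) = letter_rep 2 1 (R_typeI \<theta>) n k * word_mat \<theta> n w"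
  by (simp_all add: word_mat_def)

lemma letter_rep_eq:
  "letter_rep 2 1 (R_typeI \<theta>) n (i, b) =
    1\<^sub>m (2 ^ (i - Suc 0)) \<otimes>\<^sub>k (if b then R_typeI \<theta> else R_inv \<theta>) \<otimes>\<^sub>k 1\<^sub>m (2 ^ (n - i - Suc 0))"
  by (simp add: letter_rep_def tensor_pow_one mat_inv_R_typeI)

lemma letter_rep_square:
  assumes "Suc 0 \<le> i" "i < n"
  shows "letter_rep 2 1 (R_typeI \<theta>) n (i, b) \<in> square (Suc n)"
proof -
  have "letter_rep 2 1 (R_typeI \<theta>) n (i, b) \<in> square (i - Suc 0 + 3 + (n - i - Suc 0))"
    unfolding letter_rep_eq using R_typeI_square R_inv_square by (intro kron_square) auto
  moreover have "i - Suc 0 + 3 + (n - i - Suc 0) = Suc n" using assms by simp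
  ultimately show ?thesis by simp
qed

lemma act_letter_rep:
  assumes "Suc 0 \<le> i" "i < n" "length x = Suc n"
  shows "act (Suc n) (letter_rep 2 1 (R_typeI \<theta>) n (i, s)) \<phi> x = alpha powi (if s then 1 else - 1) *
    (\<Sum>d\<in>UNIV. crossing_weight (exp (\<i> * \<theta>)) s True True (x ! (i - Suc 0)) (x ! i) d (x ! Suc i) * \<phi> (x[i := d]))"
proof -
  have "Suc (Suc (i - Suc 0)) < length x" using assms by simp
  then obtain u a b c v where x: "x = u @ a # b # c # v" and u: "length u = i - Suc 0"
    using split_list_3 by blast
  have v: "length v = n - i - Suc 0" and i: "i = Suc (length u)" and N: "Suc n = i - Suc 0 + 3 + (n - i - Suc 0)"
    using assms x u by simp_all
  have sq: "(if s then R_typeI \<theta> else R_inv \<theta>) \<in> square 3"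
    using R_typeI_square R_inv_square by simp
  have "act (Suc n) (letter_rep 2 1 (R_typeI \<theta>) n (i, s)) \<phi> x =
      act 3 (if s then R_typeI \<theta> else R_inv \<theta>) (\<lambda>w. \<phi> (u @ w @ v)) [a, b, c]"
    using act_inner [OF sq u _ v, of "[a, b, c]" \<phi>] unfolding N letter_rep_eq x by simp
  also have "\<dots> = alpha powi (if s then 1 else - 1) *
    (\<Sum>d\<in>UNIV. crossing_weight (exp (\<i> * \<theta>)) s True True a b d c * \<phi> (u @ [a, d, c] @ v))"
    by (simp add: act_R_typeI act_R_inv power_int_minus)
  finally show ?thesis
    by (simp add: x i nth_append list_update_append Suc_diff_le)
qed

lemma word_mat_square: "w \<in> braid_words n \<Longrightarrow> word_mat \<theta> n w \<in> square (Suc n)"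
proof (induction w)
  case (Cons k w)
  obtain i b where k: "k = (i, b)" by fastforce
  with Cons show ?case
    using letter_rep_square [of i n \<theta> b] by (auto simp: braid_words_Cons)
qed simp

lemma act_word_mat:
  assumes "w \<in> braid_words n" "length x = Suc n"
  shows "act (Suc n) (word_mat \<theta> n w) \<phi> x = alpha powi word_exponent w * word_op (exp (\<i> * \<theta>)) n w \<phi> x"
  using assms
proof (induction w arbitrary: x)
  case Nil
  then show ?case using act_one [of x "Suc n"] by (simp add: word_exponent_def)
next
  case (Cons k w)
  obtain i b where k: "k = (i, b)" by fastforce
  have *: "Suc 0 \<le> i" "i < n" "w \<in> braid_words n"
    using Cons.prems by (auto simp: k braid_words_Cons)
  have IH: "act (Suc n) (word_mat \<theta> n w) \<phi> (x[i := d]) =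
      alpha powi word_exponent w * word_op (exp (\<i> * \<theta>)) n w \<phi> (x[i := d])" for d
    using Cons.IH [OF *(3), of "x[i := d]"] Cons.prems(2) by simp
  have e: "alpha powi word_exponent ((i, b) # w) = alpha powi (if b then 1 else - 1) * alpha powi word_exponent w"
    by (simp add: word_exponent_def power_int_add)
  show ?case
    unfolding k e word_mat_simps act_mult [OF letter_rep_square [OF *(1,2)] word_mat_square [OF *(3)] Cons.prems(2)]
      act_letter_rep [OF *(1,2) Cons.prems(2)] IH word_op_Cons [OF *(1,2) Cons.prems(2)]
    by (simp add: sum_distrib_left algebra_simps)
qed

lemma word_mat_move:
  assumes "diagram_move (crossings u) (crossings v)" "u \<in> braid_words n" "v \<in> braid_words n"
    and "word_exponent u = word_exponent v"
  shows "word_mat \<theta> n u = word_mat \<theta> n v"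
proof (rule mat_eq_if_act_eq [OF word_mat_square [OF assms(2)] word_mat_square [OF assms(3)]])
  fix \<phi> and x :: "bool list" assume x: "length x = Suc n"
  have "word_op (exp (\<i> * \<theta>)) n u \<phi> x = word_op (exp (\<i> * \<theta>)) n v \<phi> x"
    using diagram_move_op [OF _ assms(1), of "exp (\<i> * \<theta>)" "replicate n True" _ _ x \<phi>] x
      run_crossings [OF assms(2), of "[]"] run_crossings [OF assms(3), of "[]"] by simp
  then show "act (Suc n) (word_mat \<theta> n u) \<phi> x = act (Suc n) (word_mat \<theta> n v) \<phi> x"
    by (simp add: act_word_mat x assms)
qed

lemma kron_one_left: "1\<^sub>m 1 \<otimes>\<^sub>k A = A"
  by (rule eq_matI) (auto simp: kron_def)

lemma kron_one_right: "A \<otimes>\<^sub>k 1\<^sub>m 1 = A"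
  by (rule eq_matI) (auto simp: kron_def)

text \<open>The braid relation is the third Reidemeister move on the strands of \<open>B\<^sub>3\<close>.  The commutation relation
  for j is the exchange of the first and the last crossing on j strands; for \<open>j = 4\<close> the two
  operators share one tensor factor, on which both act diagonally.\<close>

lemma gYB_R_typeI: "gYB_operator 2 3 1 (R_typeI \<theta>)"
proof -
  let ?R = "R_typeI \<theta>"
  define I where "I = (1\<^sub>m (2 ^ 1) :: complex mat)"
  have I: "tensor_pow I r = 1\<^sub>m (2 ^ r)" for r
    unfolding I_def tensor_pow_one by simp
  have inv: "invertible_mat ?R"
    using R_typeI_square [of \<theta>] R_inv_square [of \<theta>] R_typeI_inverse [of \<theta>]
    by (auto simp: invertible_mat_def inverts_mat_def)
  have first: "letter_rep 2 1 ?R n (1, True) = ?R \<otimes>\<^sub>k tensor_pow I (n - 2)" for n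
    unfolding letter_rep_eq I using kron_one_left by (simp add: numeral_2_eq_2)
  have last: "letter_rep 2 1 ?R (Suc i) (i, True) = tensor_pow I (i - 1) \<otimes>\<^sub>k ?R" for i
    unfolding letter_rep_eq I using kron_one_right by simp
  have ybe: "(?R \<otimes>\<^sub>k I) * (I \<otimes>\<^sub>k ?R) * (?R \<otimes>\<^sub>k I) = (I \<otimes>\<^sub>k ?R) * (?R \<otimes>\<^sub>k I) * (I \<otimes>\<^sub>k ?R)"
  proof -
    define A where "A = letter_rep 2 1 ?R 3 (1, True)"
    define B where "B = letter_rep 2 1 ?R 3 (2, True)"
    have AB: "A \<in> square 4" "B \<in> square 4"
      using letter_rep_square [of 1 3 \<theta> True] letter_rep_square [of 2 3 \<theta> True] by (simp_all add: A_def B_def)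
    have "word_mat \<theta> 3 [(1, True), (2, True), (1, True)] = word_mat \<theta> 3 [(2, True), (1, True), (2, True)]"
    proof (rule word_mat_move)
      show "diagram_move (crossings [(1, True), (2, True), (1, True)]) (crossings [(2, True), (1, True), (2, True)])"
        using diagram_move.R3 [of True True True 0] by simp
    qed (simp_all add: braid_words_Cons word_exponent_def)
    then have "A * (B * A) = B * (A * B)"
      unfolding word_mat_simps A_def [symmetric] B_def [symmetric] using AB by simp
    then have "A * B * A = B * A * B"
      using AB by (simp add: assoc_mult_mat [of _ "2 ^ 4" "2 ^ 4" _ "2 ^ 4" _ "2 ^ 4"])
    moreover have "A = ?R \<otimes>\<^sub>k I" "B = I \<otimes>\<^sub>k ?R"
      using first [of 3] last [of 2] I [of 1] by (simp_all add: A_def B_def I_def)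
    ultimately show ?thesis by simp
  qed
  have far: "(?R \<otimes>\<^sub>k tensor_pow I (j - 2)) * (tensor_pow I (j - 2) \<otimes>\<^sub>k ?R) =
      (tensor_pow I (j - 2) \<otimes>\<^sub>k ?R) * (?R \<otimes>\<^sub>k tensor_pow I (j - 2))" if j4: "4 \<le> j" for j
  proof -
    obtain e where j: "j = 4 + e" using le_Suc_ex [OF j4] by blast
    let ?i = "3 + e"
    define A where "A = letter_rep 2 1 ?R j (1, True)"
    define B where "B = letter_rep 2 1 ?R j (?i, True)"
    have AB: "A \<in> square (Suc j)" "B \<in> square (Suc j)"
      using letter_rep_square [of 1 j \<theta> True] letter_rep_square [of ?i j \<theta> True] by (simp_all add: A_def B_def j)
    have "word_mat \<theta> j [(1, True), (?i, True)] = word_mat \<theta> j [(?i, True), (1, True)]"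
    proof (rule word_mat_move)
      show "diagram_move (crossings [(1, True), (?i, True)]) (crossings [(?i, True), (1, True)])"
        using diagram_move.exchange [of 0 "Cross True" e "Cross True"] by simp
    qed (simp_all add: braid_words_Cons word_exponent_def j)
    then have "A * B = B * A"
      unfolding word_mat_simps A_def [symmetric] B_def [symmetric] using AB by simp
    moreover have "B = tensor_pow I (j - 2) \<otimes>\<^sub>k ?R"
      using last [of ?i] by (simp add: B_def j)
    ultimately show ?thesis
      using first [of j] by (simp add: A_def)
  qed
  show ?thesis
    unfolding gYB_operator_def Let_def I_def [symmetric] using R_typeI_square inv ybe far by simp
qed

section \<open>The perpendicularity conditions\<close>

lemma mat_trace_square: "A \<in> square N \<Longrightarrow> mat_trace A = (\<Sum>x\<in>colourings N. A $$ (code x, code x))"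
  by (simp add: mat_trace_def sum_code)

lemma word_op_zero: "word_op z n w (\<lambda>_. 0) x = 0" if "w \<in> braid_words n" "length x = Suc n"
  using that
proof (induction w arbitrary: x)
  case (Cons k w)
  obtain i c where k: "k = (i, c)" by fastforce
  with Cons.prems have *: "Suc 0 \<le> i" "i < n" "w \<in> braid_words n"
    by (auto simp: braid_words_Cons)
  show ?case
    unfolding k word_op_Cons [OF *(1,2) Cons.prems(2)]
    using Cons.IH [OF *(3)] Cons.prems(2) by simp
qed simp

lemma word_mat_last:
  assumes "w \<in> braid_words n" "length x = Suc n" "length y = Suc n" "last x \<noteq> last y"
  shows "word_mat \<theta> n w $$ (code x, code y) = 0"
proof -
  have "word_op (exp (\<i> * \<theta>)) n w (\<lambda>x'. of_bool (x' = y)) x = word_op (exp (\<i> * \<theta>)) n w (\<lambda>_. 0) x"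
    using assms by (intro word_op_cong) auto
  then show ?thesis
    using act_word_mat [OF assms(1,2), of \<theta> "\<lambda>x'. of_bool (x' = y)"] act_indicator [OF assms(3)]
      word_op_zero [OF assms(1,2)] by simp
qed

lemma braid_rep_eq: "braid_rep 2 3 1 (R_typeI \<theta>) n \<xi> = word_mat \<theta> n (some_word \<xi>)"
  by (simp add: braid_rep_def word_mat_def num_factors_def)

lemma some_word_in_braid_words:
  assumes "\<xi> \<in> carrier (braid_group n)"
  shows "some_word \<xi> \<in> braid_words n"
proof -
  obtain u where "u \<in> braid_words n" "\<xi> = braid_class n u"
    using assms by (auto simp: carrier_braid_group)
  then show ?thesis
    using some_word_class braid_eq_words by blast
qed

text \<open>The partial trace of a crossing weight over the last colour is 1 on the diagonal, as in the first
  Reidemeister move: the two terms are \<open>(1 - \<i>) / 2\<close> and \<open>(1 + \<i>) / 2\<close>.\<close>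

lemma sum_crossing_weight_right:
  "z \<noteq> 0 \<Longrightarrow> (\<Sum>c\<in>UNIV. crossing_weight z s True True a b b c) = 1"
  by (cases s; cases a; cases b; simp add: UNIV_bool crossing_weight_def crossing_phase_def turn_def edge_def field_simps)

lemma Sp_diff_zero:
  assumes A: "A \<in> square 3" and z: "z \<noteq> 0"
    and act: "\<And>\<phi> a b c. act 3 A \<phi> [a, b, c] =
      \<kappa> * (\<Sum>d\<in>UNIV. crossing_weight z s True True a b d c * \<phi> [a, d, c])"
  shows "(Sp 2 3 1 A - \<kappa> \<cdot>\<^sub>m 1\<^sub>m (2 ^ 2)) $$ (code [a, b], code [a', b]) = 0"
proof -
  have "A $$ (code [a, b] * 2 + l, code [a', b] * 2 + l) =
      (if a = a' then \<kappa> * crossing_weight z s True True a b b (l = 1) else 0)" if "l < 2" for l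
  proof -
    have "code [a, b] * 2 + l = code [a, b, l = 1]" "code [a', b] * 2 + l = code [a', b, l = 1]"
      using that by (cases a; cases a'; cases b; cases "l = 1"; simp)+
    then have "A $$ (code [a, b] * 2 + l, code [a', b] * 2 + l) =
        \<kappa> * (\<Sum>d\<in>UNIV. crossing_weight z s True True a b d (l = 1) * of_bool ([a, d, l = 1] = [a', b, l = 1]))"
      using act_indicator [of "[a', b, l = 1]" 3 A "[a, b, l = 1]"] act [of _ a b "l = 1"] by simp
    also have "\<dots> = (if a = a' then \<kappa> * crossing_weight z s True True a b b (l = 1) else 0)"
      by (cases b) (simp_all add: UNIV_bool)
    finally show ?thesis .
  qed
  note entry = this
  have less: "code [a, b] < 4" "code [a', b] < 4"
    using code_less [of "[a, b]"] code_less [of "[a', b]"] by simp_all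
  have "Sp 2 3 1 A $$ (code [a, b], code [a', b]) = (\<Sum>l<2. A $$ (code [a, b] * 2 + l, code [a', b] * 2 + l))"
    unfolding Sp_def using less by simp
  also have "\<dots> = (if a = a' then \<kappa> * (\<Sum>c\<in>UNIV. crossing_weight z s True True a b b c) else 0)"
    using entry [of 0] entry [of 1] by (simp add: numeral_2_eq_2 lessThan_Suc UNIV_bool algebra_simps)
  finally have "Sp 2 3 1 A $$ (code [a, b], code [a', b]) = (if a = a' then \<kappa> else 0)"
    by (simp add: sum_crossing_weight_right [OF z])
  moreover have "code [a, b] = code [a', b] \<longleftrightarrow> a = a'"
    by (cases a; cases a') simp_all
  ultimately show ?thesis
    using less by (simp del: code.simps)
qed

lemma mat_adjoint_carrier: "A \<in> carrier_mat n n \<Longrightarrow> mat_adjoint A \<in> carrier_mat n n"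
  by (rule carrier_matI) (simp_all add: mat_adjoint_def mat_of_rows_def)

lemma mat_adjoint_entry:
  "A \<in> carrier_mat n n \<Longrightarrow> i < n \<Longrightarrow> j < n \<Longrightarrow> mat_adjoint A $$ (i, j) = conjugate (A $$ (j, i))"
  by (simp add: mat_adjoint_def mat_of_rows_def)

text \<open>In \<open>tr (f\<^sup>* g)\<close> every summand is a product of entries of f and g at the same place.  Braids f have
  entries only where the last colour is unchanged, g only where it changes.\<close>

lemma perp_braid_image:
  assumes n: "1 \<le> n" and X: "X \<in> square 2"
    and zero: "\<And>a a' b. X $$ (code [a, b], code [a', b]) = 0"
  shows "tensor_pow (1\<^sub>m 2) (1 * (n - 1)) \<otimes>\<^sub>k X \<in> perp (2 ^ num_factors 3 1 n) (braid_image 2 3 1 (R_typeI \<theta>) n)"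
proof -
  define g where "g = 1\<^sub>m (2 ^ (n - 1)) \<otimes>\<^sub>k X"
  have N: "Suc n = (n - 1) + 2" "num_factors 3 1 n = Suc n" using n by (simp_all add: num_factors_def)
  have g: "g \<in> square (Suc n)"
    unfolding N(1) g_def using X by (intro kron_square) auto
  have g_zero: "g $$ (code x, code y) = 0"
    if len: "length x = Suc n" "length y = Suc n" and last: "last x = last y" for x y
  proof -
    have split: "\<exists>u a b. v = u @ [a, b] \<and> length u = n - 1" if "length v = Suc n" for v :: "bool list"
      using that n by (cases v rule: rev_cases; cases "butlast v" rule: rev_cases) auto
    obtain u a b where x: "x = u @ [a, b]" "length u = n - 1" using split [OF len(1)] by blast
    obtain u' a' b' where y: "y = u' @ [a', b']" "length u' = n - 1" using split [OF len(2)] by blast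
    have "g $$ (code x, code y) = 1\<^sub>m (2 ^ (n - 1)) $$ (code u, code u') * X $$ (code [a, b], code [a', b'])"
      unfolding g_def x(1) y(1) using x y X by (intro kron_code) auto
    with last x y zero show ?thesis by (simp del: code.simps)
  qed
  have "mat_trace (mat_adjoint (word_mat \<theta> n w) * g) = 0" if w: "w \<in> braid_words n" for w
  proof -
    define f where "f = word_mat \<theta> n w"
    have f: "f \<in> square (Suc n)" using word_mat_square [OF w] by (simp add: f_def)
    have adj: "mat_adjoint f \<in> square (Suc n)"
      using f by (rule mat_adjoint_carrier)
    have "mat_adjoint f $$ (code x, code y) * g $$ (code y, code x) = 0" if "length x = Suc n" "length y = Suc n" for x y
    proof (cases "last x = last y")
      case True
      then show ?thesis using g_zero that by simp
    next
      case False
      then have "f $$ (code y, code x) = 0"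
        unfolding f_def using word_mat_last [OF w] that by metis
      then show ?thesis
        using mat_adjoint_entry [OF f code_less_power code_less_power, of x y] that by simp
    qed
    note zero_entry = this
    have "(mat_adjoint f * g) $$ (code x, code x) = 0" if "length x = Suc n" for x
      unfolding mat_mult_code [OF adj g that that]
      by (rule sum.neutral) (use zero_entry that in auto)
    moreover have "mat_adjoint f * g \<in> square (Suc n)"
      using adj g by (rule mult_carrier_mat)
    ultimately show ?thesis
      by (auto simp: mat_trace_square [of _ "Suc n"] f_def [symmetric] simp del: power_Suc intro!: sum.neutral)
  qed
  then have "mat_trace (mat_adjoint f * g) = 0" if "f \<in> braid_image 2 3 1 (R_typeI \<theta>) n" for f
    using that some_word_in_braid_words unfolding braid_image_def braid_rep_eq by blast
  then show ?thesis
    using g unfolding perp_def N(2) tensor_pow_one mult_1 g_def by blast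
qed

lemma EgYB_R_typeI: "EgYB_operator 2 3 1 (R_typeI \<theta>, 1\<^sub>m 2, alpha, 1)"
proof -
  let ?z = "exp (\<i> * complex_of_real \<theta>)"
  have I: "tensor_pow (1\<^sub>m 2) k = 1\<^sub>m (2 ^ k)" for k
    by (rule tensor_pow_one)
  have right_one: "A * 1\<^sub>m (2 ^ 3) = A" "1\<^sub>m (2 ^ 3) * A = A" if "A \<in> square 3" for A
    using right_mult_one_mat [OF that] left_mult_one_mat [OF that] by simp_all
  have dim: "Sp 2 3 1 A - \<kappa> \<cdot>\<^sub>m 1\<^sub>m (2 ^ 2) \<in> square 2" for A \<kappa>
    by (intro minus_carrier_mat smult_carrier_mat one_carrier_mat)
  have "tensor_pow (1\<^sub>m 2) (1 * (n - 1)) \<otimes>\<^sub>k (Sp 2 3 1 (R_typeI \<theta> * tensor_pow (1\<^sub>m 2) 3) - (alpha * 1) \<cdot>\<^sub>m tensor_pow (1\<^sub>m 2) (3 - 1))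
      \<in> perp (2 ^ num_factors 3 1 n) (braid_image 2 3 1 (R_typeI \<theta>) n)" if "1 \<le> n" for n
    using perp_braid_image [OF that dim Sp_diff_zero [OF R_typeI_square _ act_R_typeI]]
    unfolding I right_one [OF R_typeI_square] by simp
  moreover have "tensor_pow (1\<^sub>m 2) (1 * (n - 1)) \<otimes>\<^sub>k (Sp 2 3 1 (mat_inv (R_typeI \<theta>) * tensor_pow (1\<^sub>m 2) 3) - (inverse alpha * 1) \<cdot>\<^sub>m tensor_pow (1\<^sub>m 2) (3 - 1))
      \<in> perp (2 ^ num_factors 3 1 n) (braid_image 2 3 1 (R_typeI \<theta>) n)" if "1 \<le> n" for n
    using perp_braid_image [OF that dim Sp_diff_zero [OF R_inv_square _ act_R_inv]]
    unfolding I mat_inv_R_typeI right_one [OF R_inv_square] by simp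
  ultimately show ?thesis
    unfolding EgYB_operator_def prod.case using gYB_R_typeI
    by (simp add: I right_one [OF R_typeI_square, simplified])
qed

section \<open>The link invariant\<close>

text \<open>The factors \<open>\<alpha>\<close> and \<open>\<alpha>\<^sup>-\<^sup>1\<close> of the letters cancel against the normalisation by the exponent sum; what
  remains is the trace of a product of crossing weights.\<close>

lemma braid_invariant_eq:
  assumes "\<xi> \<in> carrier (braid_group n)"
  shows "braid_invariant 2 3 1 (R_typeI \<theta>, 1\<^sub>m 2, alpha, 1) n \<xi> =
    diagram_value (exp (\<i> * \<theta>)) (closure_diagram n (some_word \<xi>))"
proof -
  define w where "w = some_word \<xi>"
  have w: "w \<in> braid_words n"
    using some_word_in_braid_words [OF assms] by (simp add: w_def)
  have e: "exponent_sum \<xi> = word_exponent w"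
    by (simp add: exponent_sum_def word_exponent_def w_def)
  have M: "word_mat \<theta> n w \<in> square (Suc n)" by (rule word_mat_square [OF w])
  have "mat_trace (word_mat \<theta> n w) = (\<Sum>x\<in>colourings (Suc n). word_mat \<theta> n w $$ (code x, code x))"
    by (rule mat_trace_square [OF M])
  also have "\<dots> = (\<Sum>x\<in>colourings (Suc n). alpha powi word_exponent w *
      word_op (exp (\<i> * \<theta>)) n w (\<lambda>y. of_bool (y = x)) x)"
  proof (intro sum.cong HOL.refl)
    fix x assume "x \<in> colourings (Suc n)"
    then have x: "length x = Suc n" by simp
    show "word_mat \<theta> n w $$ (code x, code x) = alpha powi word_exponent w *
        word_op (exp (\<i> * \<theta>)) n w (\<lambda>y. of_bool (y = x)) x"
      using act_word_mat [OF w x] act_indicator [OF x] by metis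
  qed
  also have "\<dots> = alpha powi word_exponent w * diagram_value (exp (\<i> * \<theta>)) (closure_diagram n w)"
    by (simp add: diagram_value_closure [OF w] sum_distrib_left)
  finally have trace: "mat_trace (word_mat \<theta> n w) = \<dots>" .
  have "num_factors 3 1 n = Suc n" by (simp add: num_factors_def)
  then have rep: "braid_rep 2 3 1 (R_typeI \<theta>) n \<xi> * tensor_pow (1\<^sub>m 2) (num_factors 3 1 n) = word_mat \<theta> n w"
    using right_mult_one_mat [OF M] by (simp only: braid_rep_eq w_def tensor_pow_one)
  show ?thesis
    unfolding braid_invariant_def prod.case rep e trace w_def [symmetric] by (simp add: power_int_minus)
qed

lemma abs_oriented_link_eq_iff:
  assumes "link_diagram D" "link_diagram E"
  shows "abs_oriented_link D = abs_oriented_link E \<longleftrightarrow> isotopic D E"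
  using Quotient_rel [OF Quotient_oriented_link] isotopic.refl assms by fastforce

text \<open>The state sum takes the same value on all closures isotopic to D, so it is the value that the
  invariant singles out, provided that there is at least one such closure.\<close>

lemma link_invariant_eq:
  assumes "link_diagram D" "1 \<le> n" "w \<in> braid_words n" "isotopic (closure_diagram n w) D"
  shows "link_invariant 2 3 1 (R_typeI \<theta>, 1\<^sub>m 2, alpha, 1) (abs_oriented_link D) = diagram_value (exp (\<i> * \<theta>)) D"
  unfolding link_invariant_def
proof (rule the_equality)
  have closure: "braid_closure m \<xi> = abs_oriented_link D \<longleftrightarrow> isotopic (closure_diagram m (some_word \<xi>)) D"
    if "\<xi> \<in> carrier (braid_group m)" for m \<xi>
    unfolding braid_closure_def
    by (intro abs_oriented_link_eq_iff link_diagram_closure some_word_in_braid_words that assms(1))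
  have \<xi>: "braid_class n w \<in> carrier (braid_group n)"
    using assms(3) by (simp add: carrier_braid_group)
  have iso: "isotopic (closure_diagram n (some_word (braid_class n w))) D"
    using braid_eq_isotopic [OF some_word_class [OF assms(3)]] assms(4)
    by (blast intro: isotopic.sym isotopic.trans)
  then have "diagram_value (exp (\<i> * \<theta>)) D =
      braid_invariant 2 3 1 (R_typeI \<theta>, 1\<^sub>m 2, alpha, 1) n (braid_class n w)"
    unfolding braid_invariant_eq [OF \<xi>] using diagram_value_isotopic [OF _ iso] by simp
  then show "\<exists>m\<ge>1. \<exists>\<xi>\<in>carrier (braid_group m). braid_closure m \<xi> = abs_oriented_link D \<and>
      diagram_value (exp (\<i> * \<theta>)) D = braid_invariant 2 3 1 (R_typeI \<theta>, 1\<^sub>m 2, alpha, 1) m \<xi>"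
    using assms(2) \<xi> iso closure by blast
  fix t assume "\<exists>m\<ge>1. \<exists>\<xi>\<in>carrier (braid_group m). braid_closure m \<xi> = abs_oriented_link D \<and>
      t = braid_invariant 2 3 1 (R_typeI \<theta>, 1\<^sub>m 2, alpha, 1) m \<xi>"
  then obtain m \<xi> where \<xi>: "\<xi> \<in> carrier (braid_group m)" "braid_closure m \<xi> = abs_oriented_link D"
    and t: "t = braid_invariant 2 3 1 (R_typeI \<theta>, 1\<^sub>m 2, alpha, 1) m \<xi>"
    by blast
  then have "isotopic (closure_diagram m (some_word \<xi>)) D"
    using closure by blast
  then show "t = diagram_value (exp (\<i> * \<theta>)) D"
    unfolding t braid_invariant_eq [OF \<xi>(1)] using diagram_value_isotopic by simp
qed

lemma braid_closure_class:
  assumes "w \<in> braid_words n"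
  shows "braid_closure n (braid_class n w) = abs_oriented_link (closure_diagram n w)"
proof -
  have "isotopic (closure_diagram n (some_word (braid_class n w))) (closure_diagram n w)"
    using braid_eq_isotopic [OF some_word_class [OF assms]] by (rule isotopic.sym)
  then show ?thesis
    unfolding braid_closure_def by (rule Quotient_rel_abs [OF Quotient_oriented_link])
qed

theorem theorem4p1p2:
  fixes \<theta> :: real
  assumes "0 \<le> \<theta>" and "\<theta> \<le> pi"
    and "S = (R_typeI \<theta>, 1\<^sub>m 2, exp (\<i> * pi / 4), 1)"
    and "T = link_invariant 2 3 1 S"
  shows "EgYB_operator 2 3 1 S \<and>
    (\<forall>n\<ge>1. \<forall>\<xi>\<in>carrier (braid_group n).
       T (braid_closure n \<xi>) = braid_invariant 2 3 1 S n \<xi>) \<and>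
    (\<forall>Lm L0 Lp. skein_triple Lm L0 Lp \<longrightarrow> T Lp + T Lm = T L0) \<and>
    (\<forall>n\<ge>1. T (trivial_link n) = 2 ^ (n + 1))"
proof (intro conjI allI impI ballI)
  let ?z = "exp (\<i> * complex_of_real \<theta>)"
  have T_closure: "T (abs_oriented_link (closure_diagram n w)) = diagram_value ?z (closure_diagram n w)"
    if "1 \<le> n" "w \<in> braid_words n" for n w
    unfolding assms(3,4)
    by (rule link_invariant_eq [OF _ that]) (use that(2) in \<open>auto intro: link_diagram_closure isotopic.refl\<close>)
  show "EgYB_operator 2 3 1 S"
    unfolding assms(3) by (rule EgYB_R_typeI)
  show "T (braid_closure n \<xi>) = braid_invariant 2 3 1 S n \<xi>"
    if "1 \<le> n" "\<xi> \<in> carrier (braid_group n)" for n \<xi>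
    unfolding braid_closure_def T_closure [OF that(1) some_word_in_braid_words [OF that(2)]]
    unfolding assms(3) braid_invariant_eq [OF that(2)] ..
  show "T Lp + T Lm = T L0" if triple: "skein_triple Lm L0 Lp" for Lm L0 Lp
  proof -
    obtain n \<xi> where n: "2 \<le> n" and "\<xi> \<in> carrier (braid_group n)"
      and L: "L0 = braid_closure n \<xi>" "Lp = braid_closure n (braid_gen n 1 \<otimes>\<^bsub>braid_group n\<^esub> \<xi>)"
        "Lm = braid_closure n (inv\<^bsub>braid_group n\<^esub> (braid_gen n 1) \<otimes>\<^bsub>braid_group n\<^esub> \<xi>)"
      using triple unfolding skein_triple_def by blast
    then obtain w where w: "w \<in> braid_words n" "\<xi> = braid_class n w"
      by (auto simp: carrier_braid_group)
    have letter: "[(1, b)] \<in> braid_words n" "(1, b) # w \<in> braid_words n" for b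
      using n w(1) by (simp_all add: braid_words_Cons)
    have mult: "braid_class n [(1, b)] \<otimes>\<^bsub>braid_group n\<^esub> \<xi> = braid_class n ((1, b) # w)" for b
      using braid_group_mult [OF letter(1) w(1)] w(2) by simp
    have inv: "inv\<^bsub>braid_group n\<^esub> (braid_gen n 1) = braid_class n [(1, False)]"
      using n by (intro inv_braid_gen) auto
    have "1 \<le> n" using n by simp
    then show ?thesis
      unfolding L inv unfolding braid_gen_def mult
      using T_closure [OF _ letter(2)] T_closure [OF _ w(1)] diagram_value_skein [OF _ w(1) n, of ?z]
      by (simp only: braid_closure_class [OF letter(2)] braid_closure_class [OF w(1)] w(2) exp_not_eq_zero
          not_False_eq_True simp_thms)
  qed
  show "T (trivial_link n) = 2 ^ (n + 1)" if "1 \<le> n" for n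
  proof -
    have "diagram_value ?z (closure_diagram n []) = 2 ^ (n + 1)"
      using diagram_value_isotopic [OF _ closure_identity_trivial, of ?z n] diagram_value_trivial by simp
    then show ?thesis
      unfolding trivial_link_closure using T_closure [OF that, of "[]"] by simp
  qed
qed

end
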